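(* Let $X$ be a complex Banach space and let $(S(t))_{t\ge 0}$ be a non-degenerate integrated semigroup on $X$ with generator $A$. Then for all $t>0$: $$\left\{\int_0^t e^{\lambda s}\,ds : \lambda\in\sigma_{Sap}(A)\right\}\subseteq \sigma_{Sap}(S(t)),\qquad \left\{\int_0^t e^{\lambda s}\,ds : \lambda\in\sigma^{e}_{Sap}(A)\right\}\subseteq \sigma^{e}_{Sap}(S(t)).$$
   Context: Integrated semigroups: a family $(S(t))_{t\ge 0}$ of bounded linear operators on $X$ is an integrated semigroup if $S(0)=0$, $t\mapsto S(t)$ is strongly continuous on $[0,\infty)$, and $S(r)S(t)=\int_0^r (S(\tau+t)-S(\tau))\,d\tau=S(t)S(r)$ for all $r,t\ge 0$ (integrals taken strongly). It is non-degenerate if $\{x\in X: S(t)x=0\ \forall t\ge 0\}=\{0\}$. Let $C^1=\{x\in X: S(\cdot)x\in C^1(\mathbb{R}^+;X)\}$. The generator $A:D(A)\subseteq X\to X$ of a non-degenerate integrated semigroup is defined by: $x\in D(A)$ and $Ax=y$ iff $x\in C^1$ and $S'(t)x-x=S(t)y$ for all $t\ge 0$. It is a closed linear operator. For a closed linear operator $B$ on $X$ with domain $D(B)$, $R(B)$ is its range, $N(B)$ its null space and $R^\infty(B)=\bigcap_{n\ge 0}R(B^n)$. A closed operator $C$ is a generalized inverse of $B$ if $R(B)\subseteq D(C)$, $R(C)\subseteq D(B)$, $BCB=B$ on $D(B)$ and $CBC=C$ on $D(C)$. For subspaces $M,N$ of $X$, $M\subseteq^{e}N$ means that there is a finite-dimensional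 subspace $F\subset X$ with $M\subseteq N+F$. $B$ is Saphar if $B$ has a generalized inverse and $N(B)\subseteq R^\infty(B)$; $B$ is essentially Saphar if $B$ has a generalized inverse and $N(B)\subseteq^{e}R^\infty(B)$. The spectra are $\sigma_{Sap}(B)=\{\lambda\in\mathbb{C}: B-\lambda \text{ is not Saphar}\}$ and $\sigma^{e}_{Sap}(B)=\{\lambda\in\mathbb{C}: B-\lambda\text{ is not essentially Saphar}\}$. *)

theory Defs
  imports "HOL-Analysis.Analysis" "HOL-Library.Set_Algebras"
begin

section \<open>Complex Banach spaces\<close>

class scaleC =
  fixes scaleC :: "complex \<Rightarrow> 'a \<Rightarrow> 'a" (infixr "*\<^sub>C" 75)

text \<open>
  The complex structure extends the real one that the library's analysis is based on.
\<close>

class complex_vector = scaleC + real_vector +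
  assumes scaleC_add_right: "a *\<^sub>C (x + y) = a *\<^sub>C x + a *\<^sub>C y"
    and scaleC_add_left: "(a + b) *\<^sub>C x = a *\<^sub>C x + b *\<^sub>C x"
    and scaleC_scaleC: "a *\<^sub>C b *\<^sub>C x = (a * b) *\<^sub>C x"
    and scaleC_of_real: "complex_of_real r *\<^sub>C x = r *\<^sub>R x"

class complex_normed_vector = complex_vector + real_normed_vector +
  assumes norm_scaleC: "norm (a *\<^sub>C x) = cmod a * norm x"

class complex_banach = complex_normed_vector + banach

instantiation complex :: complex_banach
begin

definition scaleC_complex :: "complex \<Rightarrow> complex \<Rightarrow> complex"
  where "scaleC_complex a x = a * x"

instance
  by standard (simp_all add: scaleC_complex_def algebra_simps norm_mult scaleR_conv_of_real)

end

lemma scaleC_one: "1 *\<^sub>C x = (x :: 'a :: complex_vector)"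
  using scaleC_of_real[of 1 x] by simp

global_interpretation complex_vector:
  vector_space "scaleC :: complex \<Rightarrow> 'a \<Rightarrow> 'a :: complex_vector"
  by unfold_locales
    (simp_all add: scaleC_add_right scaleC_add_left scaleC_scaleC scaleC_one)

definition bounded_clinear :: "('a :: complex_normed_vector \<Rightarrow> 'b :: complex_normed_vector) \<Rightarrow> bool"
  where "bounded_clinear T \<longleftrightarrow> bounded_linear T \<and> (\<forall>c x. T (c *\<^sub>C x) = c *\<^sub>C T x)"


section \<open>Closed linear operators\<close>

text \<open>
  A possibly unbounded operator \<open>B\<close> with domain \<open>D(B)\<close> is represented by its graph, a relation on
  the space.  Thus \<open>D(B)\<close> is \<^const>\<open>Domain\<close>, \<open>R(B)\<close> is \<^const>\<open>Range\<close>, and composition and powers,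
  with their natural (maximal) domains, are relational composition \<open>O\<close> and the relational
  power \<open>B ^^ n\<close> (with \<open>B ^^ 0 = Id\<close>).
\<close>

definition linear_operator :: "('a :: complex_vector) rel \<Rightarrow> bool"
  where "linear_operator B \<longleftrightarrow>
    single_valued B \<and> (0, 0) \<in> B \<and>
    (\<forall>x y x' y'. (x, y) \<in> B \<longrightarrow> (x', y') \<in> B \<longrightarrow> (x + x', y + y') \<in> B) \<and>
    (\<forall>c x y. (x, y) \<in> B \<longrightarrow> (c *\<^sub>C x, c *\<^sub>C y) \<in> B)"

definition closed_operator :: "('a :: complex_normed_vector) rel \<Rightarrow> bool"
  where "closed_operator B \<longleftrightarrow> linear_operator B \<and> closed B"

definition operator_of :: "('a \<Rightarrow> 'a) \<Rightarrow> 'a rel"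
  where "operator_of T = {(x, y). y = T x}"

text \<open>\<open>minus_scalar B c\<close> is \<open>B - c I\<close>, with domain \<open>D(B)\<close>.\<close>

definition minus_scalar :: "('a :: complex_vector) rel \<Rightarrow> complex \<Rightarrow> 'a rel"
  where "minus_scalar B c = {(x, y - c *\<^sub>C x) | x y. (x, y) \<in> B}"

definition null_space :: "('a :: zero) rel \<Rightarrow> 'a set"
  where "null_space B = {x. (x, 0) \<in> B}"

definition range_infinity :: "'a rel \<Rightarrow> 'a set"
  where "range_infinity B = (\<Inter>n. Range (B ^^ n))"

text \<open>
  Once \<open>R(B) \<subseteq> D(C)\<close> and \<open>R(C) \<subseteq> D(B)\<close>, the operator \<open>BCB\<close> has domain \<open>D(B)\<close> and \<open>CBC\<close> has
  domain \<open>D(C)\<close>, so the equations on \<open>D(B)\<close> and \<open>D(C)\<close> are equalities of graphs.  The generalized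
  inverse \<open>C\<close> is allowed to be unbounded.
\<close>

definition generalized_inverse :: "('a :: complex_normed_vector) rel \<Rightarrow> 'a rel \<Rightarrow> bool"
  where "generalized_inverse B C \<longleftrightarrow>
    closed_operator C \<and> Range B \<subseteq> Domain C \<and> Range C \<subseteq> Domain B \<and>
    B O C O B = B \<and> C O B O C = C"

definition finite_dim_subspace :: "('a :: complex_vector) set \<Rightarrow> bool"
  where "finite_dim_subspace F \<longleftrightarrow> (\<exists>T. finite T \<and> F = complex_vector.span T)"

definition essentially_subset :: "('a :: complex_vector) set \<Rightarrow> 'a set \<Rightarrow> bool"
  where "essentially_subset M N \<longleftrightarrow> (\<exists>F. finite_dim_subspace F \<and> M \<subseteq> N + F)"


section \<open>The Saphar spectra\<close>

definition saphar :: "('a :: complex_normed_vector) rel \<Rightarrow> bool"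
  where "saphar B \<longleftrightarrow> (\<exists>C. generalized_inverse B C) \<and> null_space B \<subseteq> range_infinity B"

definition essentially_saphar :: "('a :: complex_normed_vector) rel \<Rightarrow> bool"
  where "essentially_saphar B \<longleftrightarrow>
    (\<exists>C. generalized_inverse B C) \<and> essentially_subset (null_space B) (range_infinity B)"

definition saphar_spectrum :: "('a :: complex_normed_vector) rel \<Rightarrow> complex set"
  where "saphar_spectrum B = {c. \<not> saphar (minus_scalar B c)}"

definition ess_saphar_spectrum :: "('a :: complex_normed_vector) rel \<Rightarrow> complex set"
  where "ess_saphar_spectrum B = {c. \<not> essentially_saphar (minus_scalar B c)}"


section \<open>Integrated semigroups\<close>

text \<open>
  A family \<open>(S(t))\<close> indexed by \<open>t \<ge> 0\<close> is a function on the reals whose values at negative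
  arguments are irrelevant.
\<close>

definition integrated_semigroup :: "(real \<Rightarrow> 'a :: complex_banach \<Rightarrow> 'a) \<Rightarrow> bool"
  where "integrated_semigroup S \<longleftrightarrow>
    (\<forall>t\<ge>0. bounded_clinear (S t)) \<and>
    (\<forall>x. S 0 x = 0) \<and>
    (\<forall>x. continuous_on {0..} (\<lambda>t. S t x)) \<and>
    (\<forall>r\<ge>0. \<forall>t\<ge>0. \<forall>x.
      S r (S t x) = integral {0..r} (\<lambda>\<tau>. S (\<tau> + t) x - S \<tau> x) \<and>
      S t (S r x) = integral {0..r} (\<lambda>\<tau>. S (\<tau> + t) x - S \<tau> x))"

definition nondegenerate :: "(real \<Rightarrow> 'a :: complex_banach \<Rightarrow> 'a) \<Rightarrow> bool"
  where "nondegenerate S \<longleftrightarrow> {x. \<forall>t\<ge>0. S t x = 0} = {0}"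

text \<open>
  Derivatives are taken within \<open>[0,\<infinity>)\<close>, hence one-sided at \<open>0\<close>; the library's
  \<open>C1_differentiable_on\<close> would require a two-sided derivative there.
\<close>

definition C1_vectors :: "(real \<Rightarrow> 'a :: complex_banach \<Rightarrow> 'a) \<Rightarrow> 'a set"
  where "C1_vectors S = {x. \<exists>D. continuous_on {0..} D \<and>
    (\<forall>t\<ge>0. ((\<lambda>s. S s x) has_vector_derivative D t) (at t within {0..}))}"

definition generator :: "(real \<Rightarrow> 'a :: complex_banach \<Rightarrow> 'a) \<Rightarrow> 'a rel"
  where "generator S = {(x, y). x \<in> C1_vectors S \<and>
    (\<forall>t\<ge>0. vector_derivative (\<lambda>s. S s x) (at t within {0..}) - x = S t y)}"

end

theory Submission
  imports Defs
begin

text \<open>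
  Put \<open>B = A - c\<close>, let \<open>g(t)\<close> be the integral of \<open>exp (c s)\<close> over \<open>[0, t]\<close> and \<open>T = S(t) - g(t)\<close>.
  Iterated convolution with \<open>exp (c s)\<close> turns \<open>S\<close> into bounded operators \<open>D\<close>, \<open>L\<close>, \<open>L'\<close> that commute
  with \<open>B\<close> and satisfy \<open>B D = T\<close>, \<open>B L = D - k\<close>, \<open>B L' = L - k'\<close> for scalars \<open>k\<close>, \<open>k'\<close> with
  \<open>c k' + k = exp (c t) t\<^sup>2 / 2\<close>, so that \<open>k\<close> and \<open>k'\<close> do not both vanish. From \<open>B D = T\<close>,
  \<open>N(B) \<subseteq> N(T)\<close> and \<open>R(T\<^sup>n) \<subseteq> R(B\<^sup>n)\<close>, which transfers the kernel condition.

  A generalized inverse of \<open>T\<close> yields a bounded projection \<open>v\<close> onto \<open>N(T)\<close> by the closed graph theorem,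
  and conversely any bounded projection \<open>Q\<close> onto \<open>N(B)\<close> gives the closed generalized inverse
  \<open>{(B x, x). Q x = 0}\<close> of \<open>B\<close>. If \<open>k \<noteq> 0\<close>, then \<open>D v / k\<close> is such a projection. If \<open>k = 0\<close>, then
  \<open>L v / k'\<close> maps into \<open>N(B\<^sup>2)\<close> and fixes \<open>N(B)\<close>; as \<open>N(B)\<close> lies in \<open>R(T)\<close> up to finitely many
  dimensions, it can be corrected to a projection onto \<open>N(B)\<close>.
\<close>

section \<open>Countably subadditive seminorms and the closed graph theorem\<close>

text \<open>
  Zabreiko's lemma: Baire's theorem makes the unit ball of \<open>p\<close> dense in some ball around \<open>0\<close>, and
  successive approximation removes the closure.
\<close>

lemma countably_subadditive_bounded:
  fixes p :: "'a :: banach \<Rightarrow> real"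
  assumes nonneg: "\<And>x. 0 \<le> p x"
    and scale: "\<And>c x. p (c *\<^sub>R x) = \<bar>c\<bar> * p x"
    and sub: "\<And>z x. z sums x \<Longrightarrow> summable (\<lambda>n. p (z n)) \<Longrightarrow> p x \<le> (\<Sum>n. p (z n))"
  shows "\<exists>K. \<forall>x. p x \<le> K * norm x"
proof -
  define A where "A = {x. p x \<le> 1}"
  \<comment> \<open>Finite subadditivity is countable subadditivity for the series x, y, 0, 0,
    ...\<close>
  have add: "p (x + y) \<le> p x + p y" for x y
  proof -
    define z where "z n = (if n = 0 then x else if n = 1 then y else 0)" for n :: nat
    have p0: "p 0 = 0"
      using scale[of 0 0] by simp
    have "z sums (\<Sum>n\<in>{0,1}. z n)"
      by (rule sums_finite) (auto simp: z_def)
    moreover have ps: "(\<lambda>n. p (z n)) sums (\<Sum>n\<in>{0,1}. p (z n))"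
      by (rule sums_finite) (auto simp: z_def p0)
    ultimately show ?thesis
      using sub[of z "x + y"] by (auto simp: z_def sums_iff)
  qed
  have neg: "p (- x) = p x" for x
    using scale[of "-1" x] by simp
  \<comment> \<open>Countably many closed sets cover the space, so by Baire one of them contains a
    ball.\<close>
  have "(\<Union>n. closure {x. p x \<le> real (Suc n)}) = UNIV"
  proof -
    have "\<exists>n. p x \<le> real (Suc n)" for x
      using real_nat_ceiling_ge[of "p x"] by (intro exI[of _ "nat \<lceil>p x\<rceil>"]) simp
    then show ?thesis
      using closure_subset by fast
  qed
  then have "\<exists>n. interior (closure {x. p x \<le> real (Suc n)}) \<noteq> {}"
    using Baire_category_alt[of euclidean "range (\<lambda>n. closure {x. p x \<le> real (Suc n)})"]
    by (auto simp: completely_metrizable_space_euclidean)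
  then obtain n a e where e: "e > 0" and ball: "ball a e \<subseteq> closure {x. p x \<le> real (Suc n)}"
    by (metis ex_in_conv mem_interior)
  \<comment> \<open>The scale at which every vector of norm below \<open>d * r\<close> is a limit of
    vectors with \<open>p\<close> at most \<open>d\<close>, for each \<open>d > 0\<close>.\<close>
  define r where "r = e / real (Suc n)"
  have r: "r > 0"
    using e by (simp add: r_def)
  \<comment> \<open>The centre \<open>a\<close> of the ball is removed by symmetrization: half the
    difference of approximants of \<open>a + s y\<close> and \<open>a - s y\<close>, scaled back by
    \<open>s\<close>, approximates \<open>y\<close>, and its \<open>p\<close> is at most
    \<open>2 (n + 1) / (2 s) = d\<close>.\<close>
  have approx: "\<exists>z. p z \<le> d \<and> norm (y - z) < \<epsilon>" if d: "d > 0" and y: "norm y < d * r" and \<epsilon>: "\<epsilon> > 0"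
    for d y \<epsilon>
  proof -
    define s where "s = real (Suc n) / d"
    have s: "s > 0"
      using d by (simp add: s_def)
    have "norm (s *\<^sub>R y) < e"
      using y s d by (simp add: s_def r_def field_simps)
    then have "a + s *\<^sub>R y \<in> ball a e" "a - s *\<^sub>R y \<in> ball a e"
      by (auto simp: dist_norm)
    then have "a + s *\<^sub>R y \<in> closure {x. p x \<le> real (Suc n)}"
      "a - s *\<^sub>R y \<in> closure {x. p x \<le> real (Suc n)}"
      using ball by blast+
    moreover have "s * \<epsilon> > 0"
      using s \<epsilon> by simp
    ultimately obtain u v where u: "p u \<le> real (Suc n)" "dist u (a + s *\<^sub>R y) < s * \<epsilon>"
      and v: "p v \<le> real (Suc n)" "dist v (a - s *\<^sub>R y) < s * \<epsilon>"
      unfolding closure_approachable by blast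
    define z where "z = (1 / (2 * s)) *\<^sub>R (u - v)"
    have "d * p (u - v) \<le> d * (2 * real (Suc n))"
      using add[of u "- v"] neg[of v] u v d by (intro mult_left_mono) auto
    then have "p z \<le> d"
      using d unfolding z_def scale by (simp add: s_def divide_simps distrib_left mult_ac)
    moreover have "y - z = (1 / (2 * s)) *\<^sub>R (((a + s *\<^sub>R y) - u) - ((a - s *\<^sub>R y) - v))"
    proof -
      have "((a + s *\<^sub>R y) - u) - ((a - s *\<^sub>R y) - v) = (2 * s) *\<^sub>R y - (u - v)"
        unfolding mult_2 scaleR_add_left by simp
      then show ?thesis
        using s by (simp only: z_def scaleR_diff_right) simp
    qed
    then have "norm (y - z) = (1 / (2 * s)) * norm (((a + s *\<^sub>R y) - u) - ((a - s *\<^sub>R y) - v))"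
      using s by simp
    moreover have "norm (((a + s *\<^sub>R y) - u) - ((a - s *\<^sub>R y) - v)) < 2 * s * \<epsilon>"
      using norm_triangle_ineq4[of "(a + s *\<^sub>R y) - u" "(a - s *\<^sub>R y) - v"] u v
      by (simp add: dist_norm norm_minus_commute)
    ultimately show ?thesis
      using s by (intro exI[of _ z]) (simp add: pos_divide_less_eq mult_ac)
  qed
  \<comment> \<open>The k-th remainder has norm below \<open>r / 2^k\<close>, so
    \<open>approx\<close> with \<open>d = 1 / 2^k\<close> leaves a remainder below
    \<open>r / 2^(k+1)\<close>. The increments sum to \<open>x\<close>, and the geometric series
    bounds \<open>p x\<close> by 2.\<close>
  have small: "p x \<le> 2" if x: "norm x < r" for x
  proof -
    have "\<exists>s. s 0 = 0 \<and> (\<forall>k. norm (x - s k) < (1/2) ^ k * r) \<and>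
        (\<forall>k. p (s (Suc k) - s k) \<le> (1/2) ^ k)"
    proof -
      have "\<exists>s. \<forall>k. (norm (x - s k) < (1/2) ^ k * r \<and> (k = 0 \<longrightarrow> s k = 0)) \<and>
        p (s (Suc k) - s k) \<le> (1/2) ^ k"
      proof (rule dependent_nat_choice)
        show "\<exists>u. norm (x - u) < (1/2) ^ 0 * r \<and> (0 = (0::nat) \<longrightarrow> u = 0)"
          using x by auto
      next
        fix u and k :: nat
        assume u: "norm (x - u) < (1/2) ^ k * r \<and> (k = 0 \<longrightarrow> u = 0)"
        obtain z where "p z \<le> (1/2) ^ k" "norm ((x - u) - z) < (1/2) ^ Suc k * r"
          using approx[of "(1/2) ^ k" "x - u" "(1/2) ^ Suc k * r"] u r by auto
        then show "\<exists>v. (norm (x - v) < (1/2) ^ Suc k * r \<and> (Suc k = 0 \<longrightarrow> v = 0)) \<and>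
            p (v - u) \<le> (1/2) ^ k"
          by (intro exI[of _ "u + z"]) (simp add: diff_diff_eq)
      qed
      then show ?thesis
        by metis
    qed
    then obtain s where s: "s 0 = 0" "\<And>k. norm (x - s k) < (1/2) ^ k * r"
      "\<And>k. p (s (Suc k) - s k) \<le> (1/2) ^ k"
      by blast
    have "(\<lambda>k. (1/2) ^ k * r) \<longlonglongrightarrow> 0"
      by (intro tendsto_mult_left_zero LIMSEQ_power_zero) simp
    moreover have "\<forall>\<^sub>F k in sequentially. norm (x - s k) \<le> (1/2) ^ k * r"
      using s(2) by (intro always_eventually allI less_imp_le)
    ultimately have lim: "(\<lambda>k. x - s k) \<longlonglongrightarrow> 0"
      by (rule Lim_null_comparison[rotated])
    have "s \<longlonglongrightarrow> x"
      using tendsto_diff[OF tendsto_const[of x] lim] by simp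
    then have sums: "(\<lambda>k. s (Suc k) - s k) sums (x - s 0)"
      by (rule telescope_sums)
    have sumg: "(\<lambda>k. (1/2::real) ^ k) sums 2"
      using geometric_sums[of "1/2::real"] by simp
    have summ: "summable (\<lambda>k. p (s (Suc k) - s k))"
      by (rule summable_comparison_test[OF _ sums_summable[OF sumg]]) (use s(3) nonneg in auto)
    have "p x \<le> (\<Sum>k. p (s (Suc k) - s k))"
      using sub[OF sums summ] s(1) by simp
    also have "\<dots> \<le> 2"
      using suminf_le[OF s(3) summ sums_summable[OF sumg]] sums_unique[OF sumg] by simp
    finally show ?thesis .
  qed
  have "p x \<le> (4 / r) * norm x" for x
  proof (cases "x = 0")
    case True
    then show ?thesis
      using scale[of 0 0] by simp
  next
    case False
    \<comment> \<open>Brings \<open>x\<close> to norm \<open>r / 2\<close>, strictly inside the ball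
      of \<open>small\<close>; this produces the constant \<open>4 / r\<close>.\<close>
    define c where "c = r / (2 * norm x)"
    have c: "c > 0"
      using False r by (simp add: c_def)
    have "p (c *\<^sub>R x) \<le> 2"
      by (rule small) (use False r in \<open>simp add: c_def\<close>)
    then show ?thesis
      using False r c by (simp add: scale c_def field_simps)
  qed
  then show ?thesis
    by blast
qed

text \<open>The seminorm \<open>norm (f x)\<close> is countably subadditive: the partial sums of a
  series and of its image converge together, and the limit pair stays in the closed set
  \<open>G\<close>. The map is given by its graph because it arises below from relations.\<close>

lemma closed_graph_bounded_linear:
  fixes G :: "('a :: banach \<times> 'b :: banach) set"
  assumes G: "closed G"
    and add: "\<And>x y x' y'. (x, y) \<in> G \<Longrightarrow> (x', y') \<in> G \<Longrightarrow> (x + x', y + y') \<in> G"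
    and scale: "\<And>c x y. (x, y) \<in> G \<Longrightarrow> (c *\<^sub>R x, c *\<^sub>R y) \<in> G"
    and total: "\<And>x. \<exists>y. (x, y) \<in> G"
    and single: "\<And>y. (0, y) \<in> G \<Longrightarrow> y = 0"
  obtains f where "bounded_linear f" "\<And>x y. (x, y) \<in> G \<longleftrightarrow> y = f x"
proof -
  have uniq: "y = y'" if "(x, y) \<in> G" "(x, y') \<in> G" for x y y'
    using single[of "y - y'"] add[OF that(1) scale[OF that(2), of "-1"]] by simp
  obtain f where f: "\<And>x. (x, f x) \<in> G"
    using total by metis
  have G_iff: "(x, y) \<in> G \<longleftrightarrow> y = f x" for x y
    using f uniq by blast
  have f_add: "f (x + y) = f x + f y" for x y
    using G_iff add f by metis
  have f_scale: "f (c *\<^sub>R x) = c *\<^sub>R f x" for c x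
    using G_iff scale f by metis
  have lin: "linear f"
    by (rule linearI) (simp_all add: f_add f_scale)
  have "\<exists>K. \<forall>x. norm (f x) \<le> K * norm x"
  proof (rule countably_subadditive_bounded[where p = "\<lambda>x. norm (f x)"])
    fix z x
    assume z: "z sums x" and sm: "summable (\<lambda>n. norm (f (z n)))"
    have fs: "(\<lambda>n. f (z n)) sums (\<Sum>n. f (z n))"
      by (rule summable_sums[OF summable_norm_cancel[OF sm]])
    have "(\<lambda>n. ((\<Sum>i<n. z i), (\<Sum>i<n. f (z i)))) \<longlonglongrightarrow> (x, (\<Sum>n. f (z n)))"
      using z fs unfolding sums_def by (rule tendsto_Pair)
    then have "(x, (\<Sum>n. f (z n))) \<in> G"
      by (rule Lim_in_closed_set[OF G, rotated 2]) (auto simp: G_iff linear_sum[OF lin])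
    then show "norm (f x) \<le> (\<Sum>n. norm (f (z n)))"
      using summable_norm[OF sm] by (simp add: G_iff)
  qed (auto simp: f_scale)
  then obtain K where "\<And>x. norm (f x) \<le> norm x * K"
    by (auto simp: mult.commute)
  then have "bounded_linear f"
    by (rule bounded_linear_intro[OF f_add f_scale])
  then show ?thesis
    using G_iff by (rule that)
qed

text \<open>Uniform boundedness principle: the supremum of the norms is a finite seminorm, and it is
  countably subadditive because every \<open>F i\<close> is continuous.\<close>

lemma pointwise_bounded_imp_uniformly_bounded:
  fixes F :: "'i \<Rightarrow> 'a :: banach \<Rightarrow> 'b :: banach"
  assumes lin: "\<And>i. i \<in> I \<Longrightarrow> bounded_linear (F i)"
    and bdd: "\<And>x. bounded ((\<lambda>i. F i x) ` I)"
  shows "\<exists>K. \<forall>i\<in>I. \<forall>x. norm (F i x) \<le> K * norm x"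
proof (cases "I = {}")
  case False
  define p where "p x = (SUP i\<in>I. norm (F i x))" for x
  have above: "bdd_above ((\<lambda>i. norm (F i x)) ` I)" for x
    using bdd[of x] by (auto simp: bounded_iff bdd_above_def)
  have le: "norm (F i x) \<le> p x" if "i \<in> I" for i x
    unfolding p_def using above that by (rule cSUP_upper[rotated])
  have "\<exists>K. \<forall>x. p x \<le> K * norm x"
  proof (rule countably_subadditive_bounded)
    show nonneg: "0 \<le> p x" for x
      using False le norm_ge_zero order_trans by (metis ex_in_conv)
    show "p (c *\<^sub>R x) = \<bar>c\<bar> * p x" for c x
    proof (rule antisym)
      show "p (c *\<^sub>R x) \<le> \<bar>c\<bar> * p x"
        unfolding p_def[of "c *\<^sub>R x"]
        using False le by (intro cSUP_least) (auto simp: linear_simps(5)[OF lin] intro!: mult_left_mono)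
      show "\<bar>c\<bar> * p x \<le> p (c *\<^sub>R x)"
      proof (cases "c = 0")
        case True
        then show ?thesis using nonneg by simp
      next
        case c: False
        have "p x \<le> p (c *\<^sub>R x) / \<bar>c\<bar>"
          unfolding p_def[of x]
        proof (rule cSUP_least)
          fix i assume i: "i \<in> I"
          then have "F i (c *\<^sub>R x) = c *\<^sub>R F i x"
            using lin linear_simps(5) by blast
          then show "norm (F i x) \<le> p (c *\<^sub>R x) / \<bar>c\<bar>"
            using le[OF i, of "c *\<^sub>R x"] c by (simp add: field_simps)
        qed (rule False)
        then show ?thesis
          using c by (simp add: field_simps)
      qed
    qed
    fix z x
    assume z: "z sums x" and sm: "summable (\<lambda>n. p (z n))"
    show "p x \<le> (\<Sum>n. p (z n))"
      unfolding p_def[of x]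
    proof (rule cSUP_least)
      fix i assume i: "i \<in> I"
      have Fs: "(\<lambda>n. F i (z n)) sums F i x"
        using bounded_linear.sums[OF lin[OF i] z] .
      have sn: "summable (\<lambda>n. norm (F i (z n)))"
        by (rule summable_comparison_test[OF _ sm]) (use le[OF i] in auto)
      have "norm (F i x) \<le> (\<Sum>n. norm (F i (z n)))"
        using summable_norm[OF sn] sums_unique[OF Fs] by simp
      also have "\<dots> \<le> (\<Sum>n. p (z n))"
        by (rule suminf_le[OF le[OF i] sn sm])
      finally show "norm (F i x) \<le> (\<Sum>n. p (z n))" .
    qed (rule False)
  qed
  then show ?thesis
    using le order_trans by blast
qed simp

section \<open>Complex normed spaces\<close>

lemma bounded_bilinear_scaleC:
  "bounded_bilinear ((*\<^sub>C) :: complex \<Rightarrow> 'a :: complex_normed_vector \<Rightarrow> 'a)"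
proof
  fix a b :: complex and x y :: 'a and r :: real
  show "(r *\<^sub>R a) *\<^sub>C x = r *\<^sub>R (a *\<^sub>C x)"
    by (simp add: scaleC_scaleC scaleR_conv_of_real flip: scaleC_of_real)
  show "a *\<^sub>C (r *\<^sub>R x) = r *\<^sub>R (a *\<^sub>C x)"
    by (simp add: scaleC_scaleC mult.commute flip: scaleC_of_real)
  show "\<exists>K. \<forall>a x. norm (a *\<^sub>C x :: 'a) \<le> norm a * norm x * K"
    by (intro exI[of _ 1]) (simp add: norm_scaleC)
qed (simp_all add: scaleC_add_left scaleC_add_right)

lemmas continuous_on_scaleC [continuous_intros] =
  bounded_bilinear.continuous_on[OF bounded_bilinear_scaleC]

lemmas tendsto_scaleC = bounded_bilinear.tendsto[OF bounded_bilinear_scaleC]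

lemma scaleC_scaleR: "a *\<^sub>C (r *\<^sub>R x) = r *\<^sub>R (a *\<^sub>C x :: 'a :: complex_vector)"
  by (simp add: scaleC_scaleC mult.commute flip: scaleC_of_real)

lemma bounded_clinear_bounded_linear: "bounded_clinear T \<Longrightarrow> bounded_linear T"
  by (simp add: bounded_clinear_def)

lemma bounded_clinear_simps:
  assumes "bounded_clinear T"
  shows "T (x + y) = T x + T y" "T (x - y) = T x - T y" "T 0 = 0" "T (- x) = - T x"
    "T (c *\<^sub>C x) = c *\<^sub>C T x" "T (r *\<^sub>R x) = r *\<^sub>R T x"
  using assms by (auto simp: bounded_clinear_def linear_simps)

lemma bounded_clinear_scaleC: "bounded_clinear (\<lambda>x :: 'a :: complex_normed_vector. c *\<^sub>C x)"
  unfolding bounded_clinear_def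
  by (simp add: bounded_bilinear.bounded_linear_right[OF bounded_bilinear_scaleC]
      scaleC_scaleC mult.commute)

lemma bounded_clinear_compose:
  "bounded_clinear T \<Longrightarrow> bounded_clinear U \<Longrightarrow> bounded_clinear (\<lambda>x. T (U x))"
  by (auto simp: bounded_clinear_def intro: bounded_linear_compose)

lemma bounded_clinear_diff:
  "bounded_clinear T \<Longrightarrow> bounded_clinear U \<Longrightarrow> bounded_clinear (\<lambda>x. T x - U x)"
  by (auto simp: bounded_clinear_def complex_vector.scale_right_diff_distrib intro: bounded_linear_sub)

lemma bounded_clinear_ident: "bounded_clinear (\<lambda>x. x)"
  by (simp add: bounded_clinear_def)

section \<open>Finite-dimensional subspaces\<close>

text \<open>A vector \<open>a\<close> outside the closed subspace \<open>?M\<close> has positive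
  distance from it, so the coefficient of \<open>a\<close> depends boundedly on the vector, and
  limits can be taken separately in the coefficient and in \<open>?M\<close>.\<close>

lemma closed_span_finite:
  fixes T :: "'a :: complex_normed_vector set"
  assumes "finite T"
  shows "closed (complex_vector.span T)"
  using assms
proof (induction T rule: finite_induct)
  case empty
  then show ?case
    by simp
next
  case (insert a T)
  let ?M = "complex_vector.span T"
  show ?case
  proof (cases "a \<in> ?M")
    case True
    then show ?thesis
      using insert.IH by (simp add: complex_vector.span_redundant)
  next
    case False
    obtain d where d: "d > 0" and ball: "ball a d \<subseteq> - ?M"
      using insert.IH False by (metis ComplI open_Compl open_contains_ball)
    \<comment> \<open>After division by \<open>c\<close>, the vector \<open>w / c\<close> is
      \<open>a\<close> minus an element of \<open>?M\<close>, hence of norm at least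
      \<open>d\<close>.\<close>
    have coeff: "cmod c * d \<le> norm w" if w: "w - c *\<^sub>C a \<in> ?M" for w c
    proof (cases "c = 0")
      case c: False
      have "a - inverse c *\<^sub>C w = - inverse c *\<^sub>C (w - c *\<^sub>C a)"
        using c by (simp add: complex_vector.scale_right_diff_distrib scaleC_scaleC scaleC_one)
      then have "a - inverse c *\<^sub>C w \<in> ?M"
        using complex_vector.span_scale[OF w, of "- inverse c"] by simp
      then have "\<not> norm (inverse c *\<^sub>C w) < d"
        using ball by (auto simp: subset_iff dist_norm)
      then show ?thesis
        using c by (simp add: norm_scaleC norm_inverse norm_divide field_simps)
    qed simp
    show ?thesis
      unfolding closed_sequential_limits
    proof (intro allI impI, elim conjE)
      fix y l
      assume "\<forall>n. y n \<in> complex_vector.span (insert a T)" and lim: "y \<longlonglongrightarrow> l"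
      then have "\<forall>n. \<exists>c. y n - c *\<^sub>C a \<in> ?M"
        by (simp add: complex_vector.span_insert)
      then obtain c where c: "\<And>n. y n - c n *\<^sub>C a \<in> ?M"
        by metis
      have "Cauchy c"
      proof (rule CauchyI)
        fix e :: real assume e: "e > 0"
        obtain N where N: "\<And>m n. m \<ge> N \<Longrightarrow> n \<ge> N \<Longrightarrow> norm (y m - y n) < e * d"
          using CauchyD[OF LIMSEQ_imp_Cauchy[OF lim], of "e * d"] e d by auto
        have "norm (c m - c n) < e" if "m \<ge> N" "n \<ge> N" for m n
        proof -
          have "(y m - y n) - (c m - c n) *\<^sub>C a \<in> ?M"
            using complex_vector.span_diff[OF c[of m] c[of n]]
            by (simp add: complex_vector.scale_left_diff_distrib algebra_simps)
          then have "norm (c m - c n) * d \<le> norm (y m - y n)"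
            by (rule coeff)
          also have "\<dots> < e * d"
            by (rule N[OF that])
          finally show ?thesis
            using d by simp
        qed
        then show "\<exists>N. \<forall>m\<ge>N. \<forall>n\<ge>N. norm (c m - c n) < e"
          by blast
      qed
      then obtain c' where "c \<longlonglongrightarrow> c'"
        using Cauchy_convergent convergent_def by blast
      then have "(\<lambda>n. y n - c n *\<^sub>C a) \<longlonglongrightarrow> l - c' *\<^sub>C a"
        using lim by (intro tendsto_diff tendsto_scaleC tendsto_const)
      then have "l - c' *\<^sub>C a \<in> ?M"
        by (rule closed_sequentially[OF insert.IH, rotated]) (rule c)
      then show "l \<in> complex_vector.span (insert a T)"
        by (auto simp: complex_vector.span_insert)
    qed
  qed
qed

text \<open>Modulo \<open>R\<close> the image of \<open>W\<close> under \<open>\<phi>\<close> is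
  finite-dimensional; the span of \<open>E\<close> is a lift of it on which \<open>\<phi>\<close> is
  injective modulo \<open>R\<close>. Each generator in \<open>T\<close> contributes at most one
  vector to \<open>E\<close>. Linearity is asked on \<open>W\<close> alone, since
  \<open>\<phi>\<close> will come from an operator that is not defined everywhere.\<close>

lemma finite_dim_complement_preimage:
  fixes \<phi> :: "'a :: complex_vector \<Rightarrow> 'a"
  assumes T: "finite T"
    and R: "complex_vector.subspace R" and W: "complex_vector.subspace W"
    and add: "\<And>x y. x \<in> W \<Longrightarrow> y \<in> W \<Longrightarrow> \<phi> (x + y) = \<phi> x + \<phi> y"
    and scale: "\<And>c x. x \<in> W \<Longrightarrow> \<phi> (c *\<^sub>C x) = c *\<^sub>C \<phi> x"
    and sub: "\<phi> ` W \<subseteq> R + complex_vector.span T"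
  shows "\<exists>E\<subseteq>W. finite E \<and> (\<forall>z\<in>complex_vector.span E. \<phi> z \<in> R \<longrightarrow> z = 0) \<and>
    (\<forall>w\<in>W. \<exists>z\<in>complex_vector.span E. \<phi> w - \<phi> z \<in> R)"
  using T W add scale sub
proof (induction T arbitrary: W rule: finite_induct)
  case empty
  have "\<phi> 0 = 0"
    using empty.prems(3)[of 0 0] complex_vector.subspace_0[OF empty.prems(1)] by simp
  moreover have "\<phi> w \<in> R" if "w \<in> W" for w
    using empty.prems(4) that by (auto simp: set_plus_def)
  ultimately show ?case
    by (intro exI[of _ "{}"]) auto
next
  case (insert a T)
  note W = insert.prems(1) and add = insert.prems(2) and scale = insert.prems(3)
  let ?sT = "complex_vector.span T"
  have RT: "complex_vector.subspace (R + ?sT)"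
  proof -
    have "R + ?sT = {x + y |x y. x \<in> R \<and> y \<in> ?sT}"
      by (auto simp: set_plus_def)
    then show ?thesis
      using complex_vector.subspace_sums[OF R complex_vector.subspace_span[of T]] by simp
  qed
  \<comment> \<open>The vectors handled without the generator \<open>a\<close>. This subspace has
    codimension at most one in \<open>W\<close>, because \<open>\<phi> w\<close> is a multiple of
    \<open>a\<close> modulo \<open>R + ?sT\<close>.\<close>
  define W1 where "W1 = {w \<in> W. \<phi> w \<in> R + ?sT}"
  have phi0: "\<phi> 0 = 0"
    using scale[of 0 0] complex_vector.subspace_0[OF W] by simp
  have W1: "complex_vector.subspace W1"
  proof (rule complex_vector.subspaceI)
    show "0 \<in> W1"
      using complex_vector.subspace_0[OF W] complex_vector.subspace_0[OF RT] phi0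
      by (simp add: W1_def)
    show "x + y \<in> W1" if "x \<in> W1" "y \<in> W1" for x y
      using that complex_vector.subspace_add[OF W] complex_vector.subspace_add[OF RT] add
      by (simp add: W1_def)
    show "c *\<^sub>C x \<in> W1" if "x \<in> W1" for c x
      using that complex_vector.subspace_scale[OF W] complex_vector.subspace_scale[OF RT] scale
      by (simp add: W1_def)
  qed
  have phidiff: "\<phi> (x - y) = \<phi> x - \<phi> y" if "x \<in> W" "y \<in> W" for x y
    using add[of x "(-1) *\<^sub>C y"] scale[of y "-1"] that complex_vector.subspace_scale[OF W, of y "-1"]
    by simp
  have "\<exists>E\<subseteq>W1. finite E \<and> (\<forall>z\<in>complex_vector.span E. \<phi> z \<in> R \<longrightarrow> z = 0) \<and>
      (\<forall>w\<in>W1. \<exists>z\<in>complex_vector.span E. \<phi> w - \<phi> z \<in> R)"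
  proof (rule insert.IH[OF W1])
    show "\<phi> (x + y) = \<phi> x + \<phi> y" if "x \<in> W1" "y \<in> W1" for x y
      using that by (simp add: W1_def add)
    show "\<phi> (c *\<^sub>C x) = c *\<^sub>C \<phi> x" if "x \<in> W1" for c x
      using that by (simp add: W1_def scale)
    show "\<phi> ` W1 \<subseteq> R + ?sT"
      unfolding W1_def by blast
  qed
  then obtain E1 where E1: "E1 \<subseteq> W1" "finite E1"
    and indep1: "\<forall>z\<in>complex_vector.span E1. \<phi> z \<in> R \<longrightarrow> z = 0"
    and cover1: "\<forall>w\<in>W1. \<exists>z\<in>complex_vector.span E1. \<phi> w - \<phi> z \<in> R"
    by (elim exE conjE) (rule that)
  have spanW1: "complex_vector.span E1 \<subseteq> W1"
    by (rule complex_vector.span_minimal[OF E1(1) W1])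
  show ?case
  proof (cases "W = W1")
    case True
    then show ?thesis
      using E1 indep1 cover1 by (intro exI[of _ E1]) simp
  next
    case False
    \<comment> \<open>Any such \<open>e\<close> supplies the one missing dimension.\<close>
    then obtain e where e: "e \<in> W" "\<phi> e \<notin> R + ?sT"
      by (auto simp: W1_def)
    have decomp: "\<exists>k. \<phi> w - k *\<^sub>C a \<in> R + ?sT" if "w \<in> W" for w
    proof -
      from that insert.prems(4) obtain r f where "r \<in> R" "f \<in> complex_vector.span (insert a T)"
        "\<phi> w = r + f"
        by (auto simp: set_plus_def)
      moreover then obtain k where "f - k *\<^sub>C a \<in> ?sT"
        by (auto simp: complex_vector.span_insert)
      ultimately have "r + (f - k *\<^sub>C a) \<in> R + ?sT" "\<phi> w - k *\<^sub>C a = r + (f - k *\<^sub>C a)"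
        by auto
      then show ?thesis
        by metis
    qed
    obtain k0 where k0: "\<phi> e - k0 *\<^sub>C a \<in> R + ?sT"
      using decomp e(1) by blast
    have k0nz: "k0 \<noteq> 0"
      using k0 e(2) by auto
    have "insert e E1 \<subseteq> W"
      using e E1(1) by (auto simp: W1_def)
    moreover have "finite (insert e E1)"
      using E1 by simp
    moreover have "z = 0" if z: "z \<in> complex_vector.span (insert e E1)" and "\<phi> z \<in> R" for z
    proof -
      obtain c where c: "z - c *\<^sub>C e \<in> complex_vector.span E1"
        using z by (auto simp: complex_vector.span_insert)
      have zW: "z \<in> W"
        using complex_vector.span_minimal[OF \<open>insert e E1 \<subseteq> W\<close> W] z by blast
      have ce: "c *\<^sub>C e \<in> W"
        using complex_vector.subspace_scale[OF W] e by blast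
      have "\<phi> z \<in> R + ?sT"
        using set_plus_intro[OF \<open>\<phi> z \<in> R\<close> complex_vector.span_zero[of T]] by simp
      moreover have "\<phi> (z - c *\<^sub>C e) \<in> R + ?sT"
        using c spanW1 by (auto simp: W1_def)
      ultimately have "\<phi> z - \<phi> (z - c *\<^sub>C e) \<in> R + ?sT"
        by (rule complex_vector.subspace_diff[OF RT])
      then have "c *\<^sub>C \<phi> e \<in> R + ?sT"
        using phidiff[OF zW ce] scale[OF e(1)] by simp
      then have "c = 0"
        using complex_vector.subspace_scale[OF RT, of "c *\<^sub>C \<phi> e" "inverse c"] e(2)
        by (cases "c = 0") (auto simp: scaleC_scaleC scaleC_one)
      then show ?thesis
        using indep1 c \<open>\<phi> z \<in> R\<close> by simp
    qed
    moreover have "\<exists>z\<in>complex_vector.span (insert e E1). \<phi> w - \<phi> z \<in> R" if w: "w \<in> W" for w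
    proof -
      obtain k where k: "\<phi> w - k *\<^sub>C a \<in> R + ?sT"
        using decomp w by blast
      \<comment> \<open>The factor cancels the \<open>a\<close>-component of
        \<open>\<phi> w\<close>, so that \<open>w - ce\<close> falls into \<open>W1\<close>.\<close>
      define ce where "ce = (k / k0) *\<^sub>C e"
      have ce: "ce \<in> W" "\<phi> ce = (k / k0) *\<^sub>C \<phi> e"
        using complex_vector.subspace_scale[OF W] e scale by (auto simp: ce_def)
      have "(\<phi> w - k *\<^sub>C a) - (k / k0) *\<^sub>C (\<phi> e - k0 *\<^sub>C a) \<in> R + ?sT"
        using k k0 complex_vector.subspace_diff[OF RT] complex_vector.subspace_scale[OF RT] by blast
      also have "(\<phi> w - k *\<^sub>C a) - (k / k0) *\<^sub>C (\<phi> e - k0 *\<^sub>C a) = \<phi> (w - ce)"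
        using k0nz by (simp add: phidiff w ce complex_vector.scale_right_diff_distrib scaleC_scaleC)
      finally have "w - ce \<in> W1"
        using complex_vector.subspace_diff[OF W w ce(1)] by (simp add: W1_def)
      then obtain z where z: "z \<in> complex_vector.span E1" "\<phi> (w - ce) - \<phi> z \<in> R"
        using cover1 by blast
      have "z \<in> W"
        using z spanW1 by (auto simp: W1_def)
      then have "\<phi> w - \<phi> (z + ce) \<in> R"
        using z ce w by (simp add: phidiff add algebra_simps)
      moreover have "z + ce \<in> complex_vector.span (insert e E1)"
        unfolding ce_def complex_vector.span_insert using z(1)
        by (intro CollectI exI[of _ "k / k0"]) simp
      ultimately show ?thesis
        by blast
    qed
    ultimately show ?thesis
      by (intro exI[of _ "insert e E1"] conjI ballI impI)
  qed
qed

section \<open>Generalized inverses\<close>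

lemma linear_operatorD:
  assumes "linear_operator B"
  shows "(0, 0) \<in> B"
    and "(x, y) \<in> B \<Longrightarrow> (x', y') \<in> B \<Longrightarrow> (x + x', y + y') \<in> B"
    and "(x, y) \<in> B \<Longrightarrow> (c *\<^sub>C x, c *\<^sub>C y) \<in> B"
    and "(x, y) \<in> B \<Longrightarrow> (x', y') \<in> B \<Longrightarrow> (x - x', y - y') \<in> B"
    and "(x, y) \<in> B \<Longrightarrow> (x, y') \<in> B \<Longrightarrow> y = y'"
proof -
  show add: "(x, y) \<in> B \<Longrightarrow> (x', y') \<in> B \<Longrightarrow> (x + x', y + y') \<in> B" for x y x' y'
    using assms by (auto simp: linear_operator_def)
  show scale: "(x, y) \<in> B \<Longrightarrow> (c *\<^sub>C x, c *\<^sub>C y) \<in> B" for x y c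
    using assms by (auto simp: linear_operator_def)
  show "(x, y) \<in> B \<Longrightarrow> (x', y') \<in> B \<Longrightarrow> (x - x', y - y') \<in> B"
    using add[of x y "(-1) *\<^sub>C x'" "(-1) *\<^sub>C y'"] scale[of x' y' "-1"] by simp
qed (use assms in \<open>auto simp: linear_operator_def single_valued_def\<close>)

text \<open>On the null space of \<open>Q\<close> the operator \<open>B\<close> is injective, and
  \<open>C\<close> is the inverse of that restriction. It is closed because \<open>B\<close> is
  closed and \<open>Q\<close> continuous; it may well be unbounded.\<close>

lemma generalized_inverse_if_projection_on_kernel:
  assumes B: "closed_operator B" and Q: "bounded_clinear Q"
    and into: "\<And>x. (Q x, 0) \<in> B" and ident: "\<And>x. (x, 0) \<in> B \<Longrightarrow> Q x = x"
  shows "\<exists>C. generalized_inverse B C"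
proof -
  have lin: "linear_operator B" and clB: "closed B"
    using B by (auto simp: closed_operator_def)
  define C where "C = {(y, x). (x, y) \<in> B \<and> Q x = 0}"
  have single: "x = x'" if "(y, x) \<in> C" "(y, x') \<in> C" for x x' y
  proof -
    have "(x - x', 0) \<in> B"
      using linear_operatorD(4)[OF lin, of x y x' y] that by (auto simp: C_def)
    then have "Q (x - x') = x - x'"
      by (rule ident)
    then show ?thesis
      using that by (simp add: C_def bounded_clinear_simps[OF Q])
  qed
  have linC: "linear_operator C"
    unfolding linear_operator_def
  proof (intro conjI allI impI)
    show "single_valued C"
      using single by (auto simp: single_valued_def)
  qed (use linear_operatorD[OF lin] in \<open>auto simp: C_def bounded_clinear_simps[OF Q]\<close>)
  have "C = (\<lambda>z. (snd z, fst z)) -` B \<inter> (\<lambda>z. Q (snd z)) -` {0}"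
    by (auto simp: C_def)
  moreover have "closed \<dots>"
    by (intro closed_Int continuous_closed_vimage clB continuous_intros
        bounded_linear.continuous[OF bounded_clinear_bounded_linear[OF Q]])
  ultimately have clC: "closed C"
    by simp
  \<comment> \<open>Subtracting \<open>Q x\<close>, an element of N(B), moves \<open>x\<close> into
    the null space of \<open>Q\<close> and leaves its image under \<open>B\<close>
    unchanged.\<close>
  have dom: "(y, x - Q x) \<in> C" if "(x, y) \<in> B" for x y
    using linear_operatorD(4)[OF lin that into[of x]] ident[OF into[of x]]
    by (simp add: C_def bounded_clinear_simps[OF Q])
  have CB: "(x, y) \<in> B" if "(y, x) \<in> C" for x y
    using that by (simp add: C_def)
  have CBB: "y = y'" if "(y, x) \<in> C" "(x, y') \<in> B" for x y y'
    using linear_operatorD(5)[OF lin CB[OF that(1)] that(2)] .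
  have "B O C O B = B"
  proof (rule set_eqI, clarify, rule iffI)
    fix x y
    show "(x, y) \<in> B" if "(x, y) \<in> B O C O B"
      using that by (elim relcompE Pair_inject) (metis CBB)
    show "(x, y) \<in> B O C O B" if "(x, y) \<in> B"
      using that dom[OF that] CB[OF dom[OF that]] by (intro relcompI)
  qed
  moreover have "C O B O C = C"
  proof (rule set_eqI, clarify, rule iffI)
    fix y x
    show "(y, x) \<in> C" if "(y, x) \<in> C O B O C"
      using that by (elim relcompE Pair_inject) (metis CBB)
    show "(y, x) \<in> C O B O C" if "(y, x) \<in> C"
      using that CB[OF that] by (intro relcompI)
  qed
  moreover have "Range B \<subseteq> Domain C" "Range C \<subseteq> Domain B"
    using dom CB by blast+
  ultimately show ?thesis
    unfolding generalized_inverse_def closed_operator_def using linC clC by blast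
qed

text \<open>\<open>p\<close> is the product \<open>C T\<close>. Its graph is closed and its domain
  is the whole space, so the closed graph theorem makes it bounded even when \<open>C\<close> is
  not.\<close>

lemma closed_operator_totalE:
  fixes C :: "('a :: complex_banach) rel" and T :: "'a \<Rightarrow> 'a"
  assumes C: "closed_operator C" and T: "bounded_clinear T"
    and total: "\<And>x. T x \<in> Domain C"
  obtains p where "bounded_clinear p" "\<And>x u. (T x, u) \<in> C \<longleftrightarrow> u = p x"
proof -
  have lin: "linear_operator C" and clC: "closed C"
    using C by (auto simp: closed_operator_def)
  note T_simps = bounded_clinear_simps[OF T]
  define G where "G = {(x, u). (T x, u) \<in> C}"
  have "G = (\<lambda>z. (T (fst z), snd z)) -` C"
    by (auto simp: G_def)
  moreover have "closed \<dots>"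
    by (intro continuous_closed_vimage clC continuous_intros
        bounded_linear.continuous[OF bounded_clinear_bounded_linear[OF T]])
  ultimately have "closed G"
    by simp
  obtain p where p: "bounded_linear p" "\<And>x u. (x, u) \<in> G \<longleftrightarrow> u = p x"
  proof (rule closed_graph_bounded_linear[OF \<open>closed G\<close>])
    show "(c *\<^sub>R x, c *\<^sub>R y) \<in> G" if "(x, y) \<in> G" for c x y
      using linear_operatorD(3)[OF lin, of "T x" y "complex_of_real c"] that
      by (simp add: G_def T_simps scaleC_of_real)
    show "\<exists>y. (x, y) \<in> G" for x
      using total[of x] by (auto simp: G_def)
    show "y = 0" if "(0, y) \<in> G" for y
      using that linear_operatorD(5)[OF lin _ linear_operatorD(1)[OF lin]]
      by (simp add: G_def T_simps)
  qed (use linear_operatorD(2)[OF lin] in \<open>auto simp: G_def T_simps\<close>)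
  have "p (c *\<^sub>C x) = c *\<^sub>C p x" for c x
    using linear_operatorD(3)[OF lin, of "T x" "p x" c] p(2)[of x "p x"] p(2)[of "c *\<^sub>C x"]
    by (simp add: G_def T_simps)
  then show ?thesis
    using p that[of p] by (simp add: bounded_clinear_def G_def)
qed

lemma mem_minus_scalar: "(x, y) \<in> minus_scalar A c \<longleftrightarrow> (x, y + c *\<^sub>C x) \<in> A"
  by (force simp: minus_scalar_def)

lemma closed_operator_minus_scalar:
  fixes A :: "('a :: complex_normed_vector) rel"
  assumes "closed_operator A"
  shows "closed_operator (minus_scalar A c)"
proof -
  have lin: "linear_operator A" and cl: "closed A"
    using assms by (auto simp: closed_operator_def)
  have "minus_scalar A c = (\<lambda>z. (fst z, snd z + c *\<^sub>C fst z)) -` A"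
    by (auto simp: mem_minus_scalar)
  also have "closed \<dots>"
    by (intro continuous_closed_vimage cl continuous_intros
        bounded_linear.continuous[OF bounded_clinear_bounded_linear[OF bounded_clinear_scaleC]])
  finally have "closed (minus_scalar A c)" .
  moreover have "linear_operator (minus_scalar A c)"
    unfolding linear_operator_def
  proof (intro conjI allI impI)
    show "single_valued (minus_scalar A c)"
      unfolding single_valued_def mem_minus_scalar using linear_operatorD(5)[OF lin] by fastforce
    show "(0, 0) \<in> minus_scalar A c"
      using linear_operatorD(1)[OF lin] by (simp add: mem_minus_scalar)
    show "(x + x', y + y') \<in> minus_scalar A c"
      if "(x, y) \<in> minus_scalar A c" "(x', y') \<in> minus_scalar A c" for x y x' y'
      using linear_operatorD(2)[OF lin that[unfolded mem_minus_scalar]]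
      by (simp add: mem_minus_scalar scaleC_add_right add_ac)
    show "(a *\<^sub>C x, a *\<^sub>C y) \<in> minus_scalar A c" if "(x, y) \<in> minus_scalar A c" for a x y
      using linear_operatorD(3)[OF lin that[unfolded mem_minus_scalar], of a]
      by (simp add: mem_minus_scalar scaleC_add_right scaleC_scaleC mult.commute)
  qed
  ultimately show ?thesis
    by (simp add: closed_operator_def)
qed

lemma saphar_imp_essentially_saphar:
  fixes A :: "('a :: complex_normed_vector) rel"
  shows "saphar A \<Longrightarrow> essentially_saphar A"
proof -
  have "finite_dim_subspace ({0} :: 'a set)"
    unfolding finite_dim_subspace_def by (intro exI[of _ "{}"]) simp
  moreover have "M \<subseteq> N + {0}" if "M \<subseteq> N" for M N :: "'a set"
    using that by simp
  ultimately show "saphar A \<Longrightarrow> essentially_saphar A"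
    unfolding saphar_def essentially_saphar_def essentially_subset_def by blast
qed

section \<open>Bounded operators divisible by a closed operator\<close>

text \<open>In the application \<open>B\<close> is \<open>A - c\<close> and \<open>T\<close> is
  \<open>S(t) - g(t)\<close>. Commutation with \<open>B\<close> turns the three factorizations into
  statements about N(B): there \<open>T\<close>, \<open>D\<close> and \<open>L\<close> act as the
  scalars 0, \<open>k\<close> and \<open>k'\<close>. By \<open>nonzero\<close>, at least one of
  \<open>D\<close> and \<open>L\<close> is a nonzero multiple of the identity on N(B).\<close>

locale resolvent_factorization =
  fixes B :: "('a :: complex_banach) rel" and T D L L' :: "'a \<Rightarrow> 'a" and k k' :: complex
  assumes B: "closed_operator B"
    and T: "bounded_clinear T" and D: "bounded_clinear D"
    and L: "bounded_clinear L" and L': "bounded_clinear L'"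
    and D_B: "\<And>x. (D x, T x) \<in> B"
    and L_B: "\<And>x. (L x, D x - k *\<^sub>C x) \<in> B"
    and L'_B: "\<And>x. (L' x, L x - k' *\<^sub>C x) \<in> B"
    and D_comm: "\<And>x y. (x, y) \<in> B \<Longrightarrow> (D x, D y) \<in> B"
    and L_comm: "\<And>x y. (x, y) \<in> B \<Longrightarrow> (L x, L y) \<in> B"
    and L'_comm: "\<And>x y. (x, y) \<in> B \<Longrightarrow> (L' x, L' y) \<in> B"
    and nonzero: "k \<noteq> 0 \<or> k' \<noteq> 0"
begin

lemma lin: "linear_operator B"
  using B by (simp add: closed_operator_def)

text \<open>\<open>B D x\<close> is computed twice: it is \<open>T x\<close> by the factorization
  and \<open>D 0 = 0\<close> by commutation. The next two lemmas make the same comparison for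
  \<open>L\<close> and \<open>L'\<close>.\<close>

lemma T_kernel: "(x, 0) \<in> B \<Longrightarrow> T x = 0"
  using linear_operatorD(5)[OF lin D_B D_comm, of x 0] by (simp add: bounded_clinear_simps[OF D])

lemma D_kernel: "(x, 0) \<in> B \<Longrightarrow> D x = k *\<^sub>C x"
  using linear_operatorD(5)[OF lin L_B L_comm, of x 0] by (simp add: bounded_clinear_simps[OF L])

lemma L_kernel: "(x, 0) \<in> B \<Longrightarrow> L x = k' *\<^sub>C x"
  using linear_operatorD(5)[OF lin L'_B L'_comm, of x 0] by (simp add: bounded_clinear_simps[OF L'])

lemma D_T: "D (T x) = T (D x)"
  using linear_operatorD(5)[OF lin D_comm[OF D_B[of x]] D_B[of "D x"]] .

text \<open>As \<open>D\<close> commutes with \<open>T\<close>, \<open>T^n = B^n D^n\<close>, so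
  every value of \<open>T^n\<close> is a value of \<open>B^n\<close>.\<close>

lemma range_infinity_T: "range_infinity (operator_of T) \<subseteq> range_infinity B"
proof -
  have "((D ^^ n) x, z) \<in> B ^^ n" if "(x, z) \<in> operator_of T ^^ n" for n x z
    using that
  proof (induction n arbitrary: x)
    case (Suc n)
    have "(T x, z) \<in> operator_of T ^^ n"
      using relpow_Suc_D2[OF Suc.prems] by (auto simp: operator_of_def)
    then have "((D ^^ n) (T x), z) \<in> B ^^ n"
      by (rule Suc.IH)
    moreover have "(D ^^ n) (T x) = T ((D ^^ n) x)"
      by (induction n) (simp_all add: D_T)
    ultimately show ?case
      using relpow_Suc_I2[OF D_B[of "(D ^^ n) x"]] by simp
  qed simp
  then show ?thesis
    unfolding range_infinity_def by blast
qed

lemma null_space_T: "null_space B \<subseteq> null_space (operator_of T)"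
  by (auto simp: null_space_def operator_of_def T_kernel)

text \<open>A bounded projection onto N(B) suffices. \<open>D\<close> carries the projection onto
  N(T) into N(B), and for \<open>k = 0\<close> the operator \<open>L\<close> carries it into N(B^2).
  The surplus in N(B^2) can be removed boundedly: its image under \<open>B\<close> is
  finite-dimensional modulo the range of \<open>T\<close>, and a part \<open>T u\<close> is
  cancelled by \<open>D u\<close>.\<close>

lemma generalized_inverse_if_essentially_saphar:
  assumes "essentially_saphar (operator_of T)"
  shows "\<exists>C. generalized_inverse B C"
proof -
  note simps = bounded_clinear_simps[OF T] bounded_clinear_simps[OF D] bounded_clinear_simps[OF L]
  obtain C F0 where C: "closed_operator C"
    and total: "Range (operator_of T) \<subseteq> Domain C"
    and TCT: "operator_of T O C O operator_of T = operator_of T"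
    and F0: "finite F0"
      "null_space (operator_of T) \<subseteq> range_infinity (operator_of T) + complex_vector.span F0"
    using assms
    by (auto simp: essentially_saphar_def essentially_subset_def finite_dim_subspace_def
        generalized_inverse_def)
  note linC = linear_operatorD[OF conjunct1[OF C[unfolded closed_operator_def]]]
  obtain p where p: "bounded_clinear p" "\<And>x u. (T x, u) \<in> C \<longleftrightarrow> u = p x"
    by (rule closed_operator_totalE[OF C T]) (use total in \<open>auto simp: operator_of_def\<close>)
  note p_simps = bounded_clinear_simps[OF p(1)]
  have Tp: "T (p x) = T x" for x
  proof -
    have "(x, T x) \<in> operator_of T O C O operator_of T"
      unfolding TCT by (simp add: operator_of_def)
    then obtain u where "(T x, u) \<in> C" "T u = T x"
      unfolding operator_of_def by fastforce
    then show ?thesis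
      by (simp add: p)
  qed
  \<comment> \<open>\<open>I - C T\<close> is the bounded projection onto N(T), a space that
    contains N(B).\<close>
  define v where "v x = x - p x" for x
  have v: "bounded_clinear v"
    unfolding v_def by (intro bounded_clinear_diff bounded_clinear_ident p)
  have Tv: "T (v x) = 0" for x
    by (simp add: v_def simps Tp)
  have v_kernel: "v x = x" if "(x, 0) \<in> B" for x
    using p(2)[of x 0] T_kernel[OF that] linC(1) by (simp add: v_def)
  have Dv: "(D (v x), 0) \<in> B" for x
    using D_B[of "v x"] by (simp add: Tv)
  show ?thesis
  proof (cases "k = 0")
    case False
    show ?thesis
    proof (rule generalized_inverse_if_projection_on_kernel[OF B])
      show "bounded_clinear (\<lambda>x. inverse k *\<^sub>C D (v x))"
        by (intro bounded_clinear_compose[OF bounded_clinear_scaleC]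
            bounded_clinear_compose[OF D] v)
      show "(inverse k *\<^sub>C D (v x), 0) \<in> B" for x
        using linear_operatorD(3)[OF lin Dv[of x], of "inverse k"] by simp
      show "inverse k *\<^sub>C D (v x) = x" if "(x, 0) \<in> B" for x
        using that False by (simp add: v_kernel D_kernel scaleC_scaleC scaleC_one)
    qed
  next
    case True
    then have k': "k' \<noteq> 0"
      using nonzero by simp
    \<comment> \<open>For \<open>k = 0\<close> this gives \<open>B L v = D v\<close>, which takes
      values in N(B), so \<open>L v\<close> takes values in N(B^2).\<close>
    have L_D: "(L x, D x) \<in> B" for x
      using L_B[of x] True by simp
    \<comment> \<open>\<open>W\<close> is N(B^2), and \<open>\<phi>\<close> is \<open>B\<close> as a
      function, meaningful on the domain of \<open>B\<close>.\<close>
    define W where "W = {w. \<exists>n. (w, n) \<in> B \<and> (n, 0) \<in> B}"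
    define \<phi> where "\<phi> w = (THE n. (w, n) \<in> B)" for w
    have \<phi>: "\<phi> w = n" if "(w, n) \<in> B" for w n
      unfolding \<phi>_def using that linear_operatorD(5)[OF lin] by blast
    have W_\<phi>: "(w, \<phi> w) \<in> B" "(\<phi> w, 0) \<in> B" if "w \<in> W" for w
      using that \<phi> by (auto simp: W_def)
    have R: "complex_vector.subspace (range T)"
    proof (rule complex_vector.subspaceI)
      show "0 \<in> range T"
        using simps(3) by (metis rangeI)
      show "x + y \<in> range T" if "x \<in> range T" "y \<in> range T" for x y
        using that by (auto simp flip: simps(1))
      show "c *\<^sub>C x \<in> range T" if "x \<in> range T" for c x
        using that by (auto simp flip: simps(5))
    qed
    have W: "complex_vector.subspace W"
    proof (rule complex_vector.subspaceI)
      show "0 \<in> W"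
        using linear_operatorD(1)[OF lin] by (auto simp: W_def)
      show "x + y \<in> W" if "x \<in> W" "y \<in> W" for x y
        using linear_operatorD(2)[OF lin W_\<phi>(1) W_\<phi>(1), OF that]
          linear_operatorD(2)[OF lin W_\<phi>(2) W_\<phi>(2), OF that] by (auto simp: W_def)
      show "c *\<^sub>C x \<in> W" if "x \<in> W" for c x
        using linear_operatorD(3)[OF lin W_\<phi>(1), OF that, of c]
          linear_operatorD(3)[OF lin W_\<phi>(2), OF that, of c] by (auto simp: W_def)
    qed
    \<comment> \<open>\<open>B\<close> maps N(B^2) into N(B), hence into the range of
      \<open>T\<close> plus the span of \<open>F0\<close>. The span of \<open>E\<close> represents
      this image modulo the range of \<open>T\<close>.\<close>
    have "\<exists>E\<subseteq>W. finite E \<and> (\<forall>z\<in>complex_vector.span E. \<phi> z \<in> range T \<longrightarrow> z = 0) \<and>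
      (\<forall>w\<in>W. \<exists>z\<in>complex_vector.span E. \<phi> w - \<phi> z \<in> range T)"
    proof (rule finite_dim_complement_preimage[OF F0(1) R W])
      show "\<phi> (x + y) = \<phi> x + \<phi> y" if "x \<in> W" "y \<in> W" for x y
        by (rule \<phi>[OF linear_operatorD(2)[OF lin W_\<phi>(1) W_\<phi>(1), OF that]])
      show "\<phi> (c *\<^sub>C x) = c *\<^sub>C \<phi> x" if "x \<in> W" for c x
        by (rule \<phi>[OF linear_operatorD(3)[OF lin W_\<phi>(1), OF that]])
      have "range_infinity (operator_of T) \<subseteq> Range (operator_of T ^^ 1)"
        unfolding range_infinity_def by blast
      then have RT: "range_infinity (operator_of T) \<subseteq> range T"
        by (auto simp: operator_of_def)
      have "\<phi> ` W \<subseteq> null_space B"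
        using W_\<phi>(2) by (auto simp: null_space_def)
      also have "\<dots> \<subseteq> range_infinity (operator_of T) + complex_vector.span F0"
        using null_space_T F0(2) by (rule subset_trans)
      also have "\<dots> \<subseteq> range T + complex_vector.span F0"
        by (rule set_plus_mono2[OF RT subset_refl])
      finally show "\<phi> ` W \<subseteq> range T + complex_vector.span F0" .
    qed
    then obtain E where E: "E \<subseteq> W" "finite E"
      and indep: "\<forall>z\<in>complex_vector.span E. \<phi> z \<in> range T \<longrightarrow> z = 0"
      and cover: "\<forall>w\<in>W. \<exists>z\<in>complex_vector.span E. \<phi> w - \<phi> z \<in> range T"
      by (elim exE conjE) (rule that)
    define Z where "Z = complex_vector.span E"
    have Z: "complex_vector.subspace Z" "closed Z" "Z \<subseteq> W"
      unfolding Z_def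
      by (simp_all add: closed_span_finite[OF E(2)] complex_vector.span_minimal[OF E(1) W])
    define w where "w x = inverse k' *\<^sub>C L (v x)" for x
    define n where "n x = inverse k' *\<^sub>C D (v x)" for x
    have w: "bounded_clinear w"
      unfolding w_def by (intro bounded_clinear_compose[OF bounded_clinear_scaleC]
            bounded_clinear_compose[OF L] v)
    have n: "bounded_clinear n"
      unfolding n_def by (intro bounded_clinear_compose[OF bounded_clinear_scaleC]
            bounded_clinear_compose[OF D] v)
    note n_simps = bounded_clinear_simps[OF n]
    have w_n: "(w x, n x) \<in> B" for x
      unfolding w_def n_def by (rule linear_operatorD(3)[OF lin L_D])
    have n_kernel: "(n x, 0) \<in> B" for x
      using linear_operatorD(3)[OF lin Dv[of x], of "inverse k'"] by (simp add: n_def)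
    \<comment> \<open>A decomposition \<open>n x = T u + B z\<close> in which membership in
      \<open>C\<close> normalizes \<open>u\<close> to \<open>C T u\<close> and so makes the pair
      unique. All conditions are linear and closed, so the pair will depend boundedly on
      \<open>x\<close>.\<close>
    define G where "G = {(x, (u, z)). z \<in> Z \<and> (T u, u) \<in> C \<and> (z, n x - T u) \<in> B}"
    have G_add: "(x + x', y + y') \<in> G" if "(x, y) \<in> G" "(x', y') \<in> G" for x y x' y'
    proof -
      obtain u z u' z' where y: "y = (u, z)" "y' = (u', z')"
        by (metis surj_pair)
      then have "(z + z', (n x - T u) + (n x' - T u')) \<in> B"
        using that by (intro linear_operatorD(2)[OF lin]) (auto simp: G_def)
      moreover have "(n x - T u) + (n x' - T u') = n (x + x') - T (u + u')"
        by (simp add: n_simps simps)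
      ultimately show ?thesis
        using that linC(2)[of "T u" u "T u'" u'] complex_vector.subspace_add[OF Z(1)]
        by (simp add: G_def y simps(1))
    qed
    have G_scale: "(c *\<^sub>C x, (c *\<^sub>C u, c *\<^sub>C z)) \<in> G" if "(x, (u, z)) \<in> G" for c x u z
    proof -
      have "(c *\<^sub>C z, c *\<^sub>C (n x - T u)) \<in> B"
        using that by (intro linear_operatorD(3)[OF lin]) (auto simp: G_def)
      moreover have "c *\<^sub>C (n x - T u) = n (c *\<^sub>C x) - T (c *\<^sub>C u)"
        by (simp add: n_simps(5) simps(5) complex_vector.scale_right_diff_distrib)
      ultimately show ?thesis
        using that linC(3)[of "T u" u c] complex_vector.subspace_scale[OF Z(1)]
        by (simp add: G_def simps(5))
    qed
    have "closed G"
    proof -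
      have "G = (\<lambda>g. snd (snd g)) -` Z \<inter> (\<lambda>g. (T (fst (snd g)), fst (snd g))) -` C \<inter>
          (\<lambda>g. (snd (snd g), n (fst g) - T (fst (snd g)))) -` B"
        by (auto simp: G_def)
      moreover have "closed \<dots>"
        using B C
        by (intro closed_Int continuous_closed_vimage Z continuous_intros
            bounded_linear.continuous[OF bounded_clinear_bounded_linear[OF T]]
            bounded_linear.continuous[OF bounded_clinear_bounded_linear[OF n]])
          (simp_all add: closed_operator_def)
      ultimately show ?thesis
        by simp
    qed
    \<comment> \<open>\<open>f x\<close> is the pair \<open>(u, z)\<close> with \<open>n x = T u + B z\<close>, \<open>u\<close> chosen by \<open>C\<close> and \<open>z\<close> in \<open>Z\<close>.\<close>
    obtain f where f: "bounded_linear f" "\<And>x y. (x, y) \<in> G \<longleftrightarrow> y = f x"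
    proof (rule closed_graph_bounded_linear[OF \<open>closed G\<close>])
      show "(c *\<^sub>R x, c *\<^sub>R y) \<in> G" if "(x, y) \<in> G" for c x y
        using G_scale[of x "fst y" "snd y" "complex_of_real c"] that
        by (simp add: scaleC_of_real scaleR_prod_def)
      show "\<exists>y. (x, y) \<in> G" for x
      proof -
        have "w x \<in> W" "\<phi> (w x) = n x"
          using w_n n_kernel \<phi> by (auto simp: W_def)
        \<comment> \<open>The preimage \<open>s\<close> is arbitrary; \<open>p s\<close> has the
          same image under \<open>T\<close> and meets the normalization in \<open>G\<close>.\<close>
        then obtain z s where z: "z \<in> Z" "n x - \<phi> z = T s"
          using cover by (auto simp: Z_def)
        have "(z, n x - T (p s)) \<in> B"
          using W_\<phi>(1)[of z] z Z(3) by (auto simp: Tp algebra_simps)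
        moreover have "(T (p s), p s) \<in> C"
          by (simp add: Tp p)
        ultimately show ?thesis
          using z by (auto simp: G_def)
      qed
      show "y = 0" if "(0, y) \<in> G" for y
      proof -
        obtain u z where y: "y = (u, z)"
          by (metis surj_pair)
        have z: "z \<in> Z" "(z, - T u) \<in> B" and u: "(T u, u) \<in> C"
          using that by (auto simp: G_def y n_simps(3))
        \<comment> \<open>\<open>B z\<close> lies in the range of \<open>T\<close>, so
          \<open>z = 0\<close> by injectivity modulo that range; then \<open>T u = 0\<close> and
          \<open>u = C 0 = 0\<close>.\<close>
        have "\<phi> z = T (- u)"
          using \<phi>[OF z(2)] by (simp add: simps(4))
        then have "z = 0"
          using indep z(1) by (simp add: Z_def)
        then have "T u = 0"
          using linear_operatorD(5)[OF lin z(2), of 0] linear_operatorD(1)[OF lin] by simp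
        then have "u = 0"
          using linC(5)[OF _ linC(1)] u by simp
        with \<open>z = 0\<close> show ?thesis
          by (simp add: y zero_prod_def)
      qed
    qed (use G_add in \<open>blast intro: that\<close>)+
    have f_scale: "f (c *\<^sub>C x) = (c *\<^sub>C fst (f x), c *\<^sub>C snd (f x))" for c x
      using G_scale[of x "fst (f x)" "snd (f x)" c] by (simp add: f(2))
    have f_fst: "bounded_clinear (\<lambda>x. fst (f x))" and f_snd: "bounded_clinear (\<lambda>x. snd (f x))"
      unfolding bounded_clinear_def
      using bounded_linear_compose[OF bounded_linear_fst f(1)]
        bounded_linear_compose[OF bounded_linear_snd f(1)]
      by (simp_all add: f_scale o_def)
    show ?thesis
    proof (rule generalized_inverse_if_projection_on_kernel[OF B])
      show "bounded_clinear (\<lambda>x. w x - D (fst (f x)) - snd (f x))"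
        by (intro bounded_clinear_diff w bounded_clinear_compose[OF D] f_fst f_snd)
      \<comment> \<open>\<open>B\<close> sends \<open>w x\<close>, \<open>D u\<close> and
        \<open>z\<close> to \<open>n x\<close>, \<open>T u\<close> and \<open>n x - T u\<close>,
        which cancel.\<close>
      show "(w x - D (fst (f x)) - snd (f x), 0) \<in> B" for x
      proof -
        have "(snd (f x), n x - T (fst (f x))) \<in> B"
          using f(2)[of x "f x"] by (auto simp: G_def split: prod.splits)
        from linear_operatorD(4)[OF lin linear_operatorD(4)[OF lin w_n[of x] D_B[of "fst (f x)"]] this]
        show ?thesis
          by simp
      qed
      \<comment> \<open>On N(B) \<open>D\<close> vanishes since \<open>k = 0\<close>, so
        \<open>n x = 0\<close>, both corrections are zero, and
        \<open>w x = L x / k' = x\<close>.\<close>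
      show "w x - D (fst (f x)) - snd (f x) = x" if "(x, 0) \<in> B" for x
      proof -
        have "n x = 0"
          using that by (simp add: n_def v_kernel D_kernel True)
        then have "(x, (0, 0)) \<in> G"
          using linear_operatorD(1)[OF lin] linC(1) complex_vector.subspace_0[OF Z(1)]
          by (simp add: G_def simps(3))
        then have "f x = (0, 0)"
          by (simp add: f(2))
        then show ?thesis
          using that k' by (simp add: w_def v_kernel L_kernel scaleC_scaleC scaleC_one simps(9))
      qed
    qed
  qed
qed

lemma essentially_saphar_transfer:
  assumes "essentially_saphar (operator_of T)"
  shows "essentially_saphar B"
proof -
  obtain F where "finite_dim_subspace F"
    "null_space (operator_of T) \<subseteq> range_infinity (operator_of T) + F"
    using assms by (auto simp: essentially_saphar_def essentially_subset_def)
  moreover have "range_infinity (operator_of T) + F \<subseteq> range_infinity B + F"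
    by (rule set_plus_mono2[OF range_infinity_T subset_refl])
  ultimately show ?thesis
    using generalized_inverse_if_essentially_saphar[OF assms] null_space_T
    unfolding essentially_saphar_def essentially_subset_def by (meson subset_trans)
qed

lemma saphar_transfer:
  assumes "saphar (operator_of T)"
  shows "saphar B"
  using generalized_inverse_if_essentially_saphar[OF saphar_imp_essentially_saphar[OF assms]]
    assms null_space_T range_infinity_T
  unfolding saphar_def by blast

end

section \<open>Convolution with an exponential\<close>

lemma integral_has_vector_derivative_Ici:
  fixes f :: "real \<Rightarrow> 'a :: banach"
  assumes f: "continuous_on {0..} f" and t: "t \<ge> 0"
  shows "((\<lambda>t. integral {0..t} f) has_vector_derivative f t) (at t within {0..})"
proof -
  have "((\<lambda>t. integral {0..t} f) has_vector_derivative f t) (at t within {0..t+1})"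
    by (rule integral_has_vector_derivative[OF continuous_on_subset[OF f]]) (use t in auto)
  also have "at t within {0..t+1} = at t within {0..}"
    by (rule at_within_nhd[of _ "{..<t+1}"]) auto
  finally show ?thesis .
qed

text \<open>Makes derivatives within \<open>{0..}\<close> unique: a connected set with several
  points has no isolated point.\<close>

lemma at_within_Ici_nontrivial:
  fixes t :: real
  assumes "t \<ge> 0"
  shows "at t within {0..} \<noteq> bot"
proof -
  have "{0..} \<noteq> {x}" for x :: real
    using infinite_Ici[of "0::real"] by (metis finite.emptyI finite.insertI)
  then have "t islimpt {0..}"
    using assms by (intro connected_imp_perfect) auto
  then show ?thesis
    by (simp add: trivial_limit_within)
qed

lemma continuous_on_integral_Ici:
  fixes f :: "real \<Rightarrow> 'a :: banach"
  assumes "continuous_on {0..} f"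
  shows "continuous_on {0..} (\<lambda>t. integral {0..t} f)"
  using integral_has_vector_derivative_Ici[OF assms]
  by (intro continuous_on_vector_derivative) auto

lemma integral_Ici_shift:
  fixes f :: "real \<Rightarrow> 'a :: banach"
  assumes f: "continuous_on {0..} f" and "a \<ge> 0" "b \<ge> 0"
  shows "integral {0..a} (\<lambda>s. f (s + b)) = integral {0..a + b} f - integral {0..b} f"
proof -
  have "f integrable_on {0..a + b}"
    by (intro integrable_continuous_real continuous_on_subset[OF f]) auto
  then have "integral {0..b} f + integral {b..a + b} f = integral {0..a + b} f"
    using assms by (intro Henstock_Kurzweil_Integration.integral_combine) auto
  then show ?thesis
    using integral_shift_real_ivl[of b b "a + b" f] by (simp add: algebra_simps)
qed

text \<open>The integral of \<open>exp (c (t - s)) f(s)\<close> over \<open>[0, t]\<close>. The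
  factor depending on \<open>t\<close> is pulled out, which leaves an integrand independent of
  \<open>t\<close>.\<close>

definition exp_convolution :: "complex \<Rightarrow> (real \<Rightarrow> 'a :: complex_banach) \<Rightarrow> real \<Rightarrow> 'a"
  where "exp_convolution c f t =
    exp (c * of_real t) *\<^sub>C integral {0..t} (\<lambda>s. exp (- (c * of_real s)) *\<^sub>C f s)"

lemma exp_convolution_0: "exp_convolution 0 f t = integral {0..t} f"
  by (simp add: exp_convolution_def scaleC_one)

context
  fixes c :: complex
begin

lemma continuous_on_exp_weight:
  fixes f :: "real \<Rightarrow> 'a :: complex_banach"
  assumes "continuous_on {0..} f"
  shows "continuous_on {0..} (\<lambda>s. exp (- (c * complex_of_real s)) *\<^sub>C f s)"
  by (intro continuous_intros assms)

lemma integrable_exp_weight: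
  fixes f :: "real \<Rightarrow> 'a :: complex_banach"
  assumes "continuous_on {0..} f"
  shows "(\<lambda>s. exp (- (c * complex_of_real s)) *\<^sub>C f s) integrable_on {0..t}"
  by (intro integrable_continuous_real continuous_on_subset[OF continuous_on_exp_weight[OF assms]]) auto

lemma continuous_on_exp_convolution:
  assumes "continuous_on {0..} f"
  shows "continuous_on {0..} (exp_convolution c f)"
  unfolding exp_convolution_def[abs_def]
  by (intro continuous_intros continuous_on_integral_Ici continuous_on_exp_weight assms)

lemma bounded_clinear_exp_convolution:
  assumes W: "bounded_clinear W" and f: "continuous_on {0..} f"
  shows "W (exp_convolution c f t) = exp_convolution c (\<lambda>s. W (f s)) t"
  using integral_linear[OF integrable_exp_weight[OF f] bounded_clinear_bounded_linear[OF W], of t]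
  by (simp add: exp_convolution_def bounded_clinear_simps[OF W] o_def)

lemma exp_convolution_add:
  assumes "continuous_on {0..} f" "continuous_on {0..} h"
  shows "exp_convolution c (\<lambda>s. f s + h s) t = exp_convolution c f t + exp_convolution c h t"
  by (simp add: exp_convolution_def scaleC_add_right
      Henstock_Kurzweil_Integration.integral_add integrable_exp_weight assms)

lemma exp_convolution_diff:
  assumes "continuous_on {0..} f" "continuous_on {0..} h"
  shows "exp_convolution c (\<lambda>s. f s - h s) t = exp_convolution c f t - exp_convolution c h t"
  by (simp add: exp_convolution_def complex_vector.scale_right_diff_distrib
      Henstock_Kurzweil_Integration.integral_diff integrable_exp_weight assms)

lemma exp_convolution_scaleC:
  assumes "continuous_on {0..} f"
  shows "exp_convolution c (\<lambda>s. a *\<^sub>C f s) t = a *\<^sub>C exp_convolution c f t"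
  using bounded_clinear_exp_convolution[OF bounded_clinear_scaleC assms] by simp

lemma exp_convolution_scaleC_left:
  fixes h :: "real \<Rightarrow> complex" and x :: "'a :: complex_banach"
  assumes "continuous_on {0..} h"
  shows "exp_convolution c (\<lambda>s. h s *\<^sub>C x) t = exp_convolution c h t *\<^sub>C x"
  using integral_linear[OF integrable_exp_weight[OF assms]
      bounded_bilinear.bounded_linear_left[OF bounded_bilinear_scaleC, of x], of t]
  by (simp add: exp_convolution_def scaleC_complex_def scaleC_scaleC o_def)

text \<open>Integration by parts of \<open>exp (- c s) f(s)\<close> with the primitive of
  \<open>f\<close>. It expresses the convolution of \<open>S\<close> through the integral of
  \<open>S\<close>, whose values lie in the domain of the generator.\<close>

lemma exp_convolution_by_parts:
  assumes f: "continuous_on {0..} f" and t: "t \<ge> 0"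
  shows "exp_convolution c f t =
    integral {0..t} f + c *\<^sub>C exp_convolution c (\<lambda>s. integral {0..s} f) t"
proof -
  define F where "F s = integral {0..s} f" for s
  define e where "e s = exp (- (c * complex_of_real s))" for s
  have F: "continuous_on {0..} F"
    unfolding F_def by (rule continuous_on_integral_Ici[OF f])
  have "((\<lambda>s. e s *\<^sub>C F s) has_vector_derivative e s *\<^sub>C f s + (- (c * e s)) *\<^sub>C F s)
      (at s within {0..t})" if "s \<in> {0..t}" for s
  proof (rule bounded_bilinear.has_vector_derivative[OF bounded_bilinear_scaleC])
    have "((\<lambda>z. exp (- (c * z))) has_field_derivative - (c * e s)) (at (of_real s))"
      unfolding e_def by (auto intro!: derivative_eq_intros)
    then show "(e has_vector_derivative - (c * e s)) (at s within {0..t})"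
      unfolding e_def[abs_def]
      using has_vector_derivative_real_field[of "\<lambda>z. exp (- (c * z))" _ s "{0..t}"] by simp
    show "(F has_vector_derivative f s) (at s within {0..t})"
      unfolding F_def using that
      by (intro has_vector_derivative_within_subset[OF integral_has_vector_derivative_Ici[OF f]]) auto
  qed
  from fundamental_theorem_of_calculus[OF t this]
  have total: "((\<lambda>s. e s *\<^sub>C f s + (- (c * e s)) *\<^sub>C F s) has_integral
      (e t *\<^sub>C F t - e 0 *\<^sub>C F 0)) {0..t}" .
  have parts: "((\<lambda>s. e s *\<^sub>C f s + (- (c * e s)) *\<^sub>C F s) has_integral
      (integral {0..t} (\<lambda>s. e s *\<^sub>C f s) + (- c) *\<^sub>C integral {0..t} (\<lambda>s. e s *\<^sub>C F s))) {0..t}"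
  proof (rule has_integral_add)
    show "((\<lambda>s. e s *\<^sub>C f s) has_integral integral {0..t} (\<lambda>s. e s *\<^sub>C f s)) {0..t}"
      unfolding e_def by (rule integrable_integral[OF integrable_exp_weight[OF f]])
    have "((\<lambda>s. e s *\<^sub>C F s) has_integral integral {0..t} (\<lambda>s. e s *\<^sub>C F s)) {0..t}"
      unfolding e_def by (rule integrable_integral[OF integrable_exp_weight[OF F]])
    from has_integral_linear[OF this
        bounded_clinear_bounded_linear[OF bounded_clinear_scaleC[of "- c"]]]
    show "((\<lambda>s. (- (c * e s)) *\<^sub>C F s) has_integral
        (- c) *\<^sub>C integral {0..t} (\<lambda>s. e s *\<^sub>C F s)) {0..t}"
      by (simp add: o_def scaleC_scaleC)
  qed
  have "integral {0..t} (\<lambda>s. e s *\<^sub>C f s) =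
      e t *\<^sub>C F t + c *\<^sub>C integral {0..t} (\<lambda>s. e s *\<^sub>C F s)"
    using has_integral_unique[OF total parts] by (simp add: F_def algebra_simps)
  moreover have "exp (c * complex_of_real t) * e t = 1"
    by (simp add: e_def flip: exp_add)
  ultimately show ?thesis
    by (simp add: exp_convolution_def scaleC_add_right scaleC_scaleC scaleC_one mult.commute
        F_def e_def)
qed

end

section \<open>Scalar convolutions\<close>

text \<open>Multiplying by \<open>c\<close> instead of dividing covers \<open>c = 0\<close> as
  well.\<close>

lemma integral_exp:
  assumes "t \<ge> 0"
  shows "c * integral {0..t} (\<lambda>s. exp (c * complex_of_real s)) = exp (c * of_real t) - 1"
proof -
  have "((\<lambda>s. c * exp (c * complex_of_real s)) has_integral
      (exp (c * of_real t) - exp (c * of_real 0))) {0..t}"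
  proof (rule fundamental_theorem_of_calculus[OF assms])
    fix s :: real
    have "((\<lambda>z. exp (c * z)) has_field_derivative c * exp (c * of_real s)) (at (of_real s))"
      by (auto intro!: derivative_eq_intros)
    then show "((\<lambda>s. exp (c * complex_of_real s)) has_vector_derivative c * exp (c * of_real s))
        (at s within {0..t})"
      by (rule has_vector_derivative_real_field)
  qed
  then show ?thesis
    by (simp flip: integral_mult_right add: integral_unique)
qed

lemma continuous_on_integral_exp:
  "continuous_on {0..} (\<lambda>t. integral {0..t} (\<lambda>s. exp (c * complex_of_real s)))"
  by (intro continuous_on_integral_Ici continuous_intros)

text \<open>The substitution of \<open>t - s\<close> for \<open>s\<close>, carried out as a
  reflection followed by a shift.\<close>

lemma exp_convolution_one:
  assumes "t \<ge> 0"
  shows "exp_convolution c (\<lambda>_. 1) t = integral {0..t} (\<lambda>s. exp (c * complex_of_real s))"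
proof -
  define e where "e s = exp (c * complex_of_real s)" for s
  have "integral {0..t} e = integral {- t..0} (\<lambda>s. e (- s))"
    using Henstock_Kurzweil_Integration.integral_reflect_real[of t 0 e, symmetric] by (simp only: minus_zero)
  also have "\<dots> = integral {- t - (- t)..0 - (- t)} (\<lambda>s. e (- (s + - t)))"
    by (rule integral_shift_real_ivl[symmetric])
  also have "\<dots> = integral {0..t} (\<lambda>s. exp (c * of_real t) * exp (- (c * complex_of_real s)))"
    by (simp add: e_def right_diff_distrib flip: exp_add)
  finally show ?thesis
    by (simp add: exp_convolution_def scaleC_complex_def e_def[abs_def])
qed

text \<open>From \<open>c g = exp (c s) - 1\<close> follows
  \<open>c k(s) = s exp (c s) - g(s)\<close>, and convolving once more gives the identity. For
  \<open>t > 0\<close> the right side is nonzero, so \<open>k\<close> and its convolution do not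
  both vanish at \<open>t\<close>.\<close>

lemma double_exp_convolution_identity:
  fixes c :: complex
  assumes t: "t \<ge> 0"
  defines "k \<equiv> exp_convolution c (\<lambda>s. integral {0..s} (\<lambda>r. exp (c * complex_of_real r)))"
  shows "c * exp_convolution c k t + k t = exp (c * of_real t) * of_real (t\<^sup>2 / 2)"
proof -
  define g where "g s = integral {0..s} (\<lambda>r. exp (c * complex_of_real r))" for s
  define e where "e s = exp (c * complex_of_real s)" for s
  have k_eq: "k = exp_convolution c g"
    by (simp add: k_def g_def[abs_def])
  have g: "continuous_on {0..} g"
    unfolding g_def by (rule continuous_on_integral_exp)
  have e: "continuous_on {0..} e"
    unfolding e_def by (intro continuous_intros)
  have k: "continuous_on {0..} k"
    unfolding k_def by (rule continuous_on_exp_convolution[OF continuous_on_integral_exp])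
  \<comment> \<open>The two exponentials cancel under the integral.\<close>
  have conv_e: "exp_convolution c (\<lambda>s. h s * e s) r = e r * integral {0..r} h"
    for h :: "real \<Rightarrow> complex" and r
  proof -
    have "(\<lambda>s. exp (- (c * complex_of_real s)) * (h s * e s)) = h"
      by (simp add: e_def exp_minus fun_eq_iff)
    then show ?thesis
      by (simp add: exp_convolution_def scaleC_complex_def) (simp add: e_def)
  qed
  have ck: "c * k r = of_real r * e r - g r" if r: "r \<ge> 0" for r
  proof -
    have "c * k r = exp_convolution c (\<lambda>s. c * g s) r"
      using exp_convolution_scaleC[OF g, of c c r] by (simp add: scaleC_complex_def k_eq)
    also have "\<dots> = exp_convolution c (\<lambda>s. e s - 1) r"
      unfolding exp_convolution_def
      by (intro arg_cong[where f = "\<lambda>y. _ *\<^sub>C y"] integral_cong)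
        (simp add: g_def e_def integral_exp)
    also have "\<dots> = exp_convolution c e r - exp_convolution c (\<lambda>_. 1) r"
      by (rule exp_convolution_diff[OF e continuous_on_const])
    also have "exp_convolution c e r = of_real r * e r"
      using conv_e[of "\<lambda>_. 1" r] r by (simp add: scaleR_conv_of_real mult.commute)
    also have "exp_convolution c (\<lambda>_. 1) r = g r"
      using r by (simp add: exp_convolution_one g_def)
    finally show ?thesis .
  qed
  have "c * exp_convolution c k t = exp_convolution c (\<lambda>s. c * k s) t"
    using exp_convolution_scaleC[OF k, of c c t] by (simp add: scaleC_complex_def)
  also have "\<dots> = exp_convolution c (\<lambda>s. of_real s * e s - g s) t"
    unfolding exp_convolution_def
    by (intro arg_cong[where f = "\<lambda>y. _ *\<^sub>C y"] integral_cong) (simp add: ck)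
  also have "\<dots> = exp_convolution c (\<lambda>s. of_real s * e s) t - k t"
    unfolding k_eq
    by (rule exp_convolution_diff[OF _ g]) (intro continuous_intros e)
  also have "exp_convolution c (\<lambda>s. of_real s * e s) t = e t * of_real (t\<^sup>2 / 2)"
  proof -
    have "((\<lambda>s. complex_of_real s) has_integral complex_of_real ((t\<^sup>2 - 0\<^sup>2) / 2)) {0..t}"
      using ident_has_integral[OF t] by (rule has_integral_of_real)
    then show ?thesis
      by (simp add: conv_e integral_unique)
  qed
  finally show ?thesis
    by (simp add: e_def)
qed

section \<open>Strongly continuous families of operators\<close>

definition strongly_continuous_family :: "(real \<Rightarrow> 'a :: complex_banach \<Rightarrow> 'a) \<Rightarrow> bool"
  where "strongly_continuous_family P \<longleftrightarrow>
    (\<forall>t\<ge>0. bounded_clinear (P t)) \<and> (\<forall>x. continuous_on {0..} (\<lambda>t. P t x))"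

lemma strongly_continuous_familyD:
  assumes "strongly_continuous_family P"
  shows "t \<ge> 0 \<Longrightarrow> bounded_clinear (P t)" "continuous_on {0..} (\<lambda>t. P t x)"
  using assms by (auto simp: strongly_continuous_family_def)

text \<open>Orbits over the compact interval \<open>{0..t}\<close> are bounded, so the uniform
  boundedness principle gives one constant \<open>K\<close> for all weighted operators there, and
  the integral is bounded by \<open>K t\<close>. This allows the convolution to be iterated.\<close>

lemma strongly_continuous_family_exp_convolution:
  assumes P: "strongly_continuous_family P"
  shows "strongly_continuous_family (\<lambda>t x. exp_convolution c (\<lambda>s. P s x) t)"
  unfolding strongly_continuous_family_def
proof (intro conjI allI impI)
  note P_lin = strongly_continuous_familyD(1)[OF P] and P_cont = strongly_continuous_familyD(2)[OF P]
  show "continuous_on {0..} (\<lambda>t. exp_convolution c (\<lambda>s. P s x) t)" for x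
    by (rule continuous_on_exp_convolution[OF P_cont])
  fix t :: real assume t: "t \<ge> 0"
  define F where "F s x = exp (- (c * complex_of_real s)) *\<^sub>C P s x" for s x
  have F_cont: "continuous_on {0..t} (\<lambda>s. F s x)" for x
    unfolding F_def by (rule continuous_on_subset[OF continuous_on_exp_weight[OF P_cont]]) auto
  have F_lin: "bounded_clinear (F s)" if "s \<in> {0..t}" for s
    unfolding F_def using that
    by (intro bounded_clinear_compose[OF bounded_clinear_scaleC] P_lin) auto
  have "\<exists>K. \<forall>s\<in>{0..t}. \<forall>x. norm (F s x) \<le> K * norm x"
    using F_lin F_cont
    by (intro pointwise_bounded_imp_uniformly_bounded bounded_clinear_bounded_linear
        compact_imp_bounded compact_continuous_image) auto
  then obtain K where K: "\<And>s x. s \<in> {0..t} \<Longrightarrow> norm (F s x) \<le> K * norm x"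
    by blast
  define I where "I x = integral {0..t} (\<lambda>s. F s x)" for x
  have F_int: "(\<lambda>s. F s x) integrable_on {0..t}" for x
    by (rule integrable_continuous_real[OF F_cont])
  have I_add: "I (x + y) = I x + I y" for x y
  proof -
    have "I (x + y) = integral {0..t} (\<lambda>s. F s x + F s y)"
      unfolding I_def by (rule integral_cong) (simp add: bounded_clinear_simps[OF F_lin])
    then show ?thesis
      by (simp add: I_def Henstock_Kurzweil_Integration.integral_add F_int)
  qed
  have I_scale: "I (a *\<^sub>C x) = a *\<^sub>C I x" for a x
  proof -
    have "I (a *\<^sub>C x) = integral {0..t} ((\<lambda>y. a *\<^sub>C y) \<circ> (\<lambda>s. F s x))"
      unfolding I_def by (rule integral_cong) (simp add: bounded_clinear_simps[OF F_lin])
    then show ?thesis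
      unfolding I_def
      using integral_linear[OF F_int bounded_clinear_bounded_linear[OF bounded_clinear_scaleC]]
      by metis
  qed
  have "I (a *\<^sub>R x) = a *\<^sub>R I x" for a x
    using I_scale[of "complex_of_real a" x] by (simp add: scaleC_of_real)
  moreover have "norm (I x) \<le> norm x * (K * t)" for x
    using integral_bound[OF t F_cont, of x "K * norm x"] K by (simp add: I_def mult_ac)
  ultimately have "bounded_linear I"
    by (rule bounded_linear_intro[OF I_add])
  then have "bounded_clinear I"
    using I_scale by (simp add: bounded_clinear_def)
  then have "bounded_clinear (\<lambda>x. exp (c * complex_of_real t) *\<^sub>C I x)"
    by (rule bounded_clinear_compose[OF bounded_clinear_scaleC])
  then show "bounded_clinear (\<lambda>x. exp_convolution c (\<lambda>s. P s x) t)"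
    by (simp add: exp_convolution_def I_def F_def)
qed

section \<open>Integrated semigroups\<close>

locale strongly_continuous_integrated_semigroup =
  fixes S :: "real \<Rightarrow> 'a :: complex_banach \<Rightarrow> 'a"
  assumes S: "integrated_semigroup S"
begin

text \<open>The values of this antiderivative lie in the domain of the generator
  (\<open>generator_V\<close>), and it brings the functional equation into the closed form
  \<open>S_S\<close>.\<close>

definition V :: "real \<Rightarrow> 'a \<Rightarrow> 'a"
  where "V t x = integral {0..t} (\<lambda>s. S s x)"

lemma S_family: "strongly_continuous_family S"
  using S by (simp add: integrated_semigroup_def strongly_continuous_family_def)

lemmas S_lin = strongly_continuous_familyD(1)[OF S_family]
lemmas S_cont = strongly_continuous_familyD(2)[OF S_family]

lemma V_family: "strongly_continuous_family V"
  using strongly_continuous_family_exp_convolution[OF S_family, of 0]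
  unfolding exp_convolution_0 V_def[abs_def] .

lemmas V_lin = strongly_continuous_familyD(1)[OF V_family]
lemmas V_cont = strongly_continuous_familyD(2)[OF V_family]

lemma S_zero: "S 0 x = 0"
  using S by (simp add: integrated_semigroup_def)

lemma S_S:
  assumes "r \<ge> 0" "t \<ge> 0"
  shows "S r (S t x) = V (r + t) x - V t x - V r x"
proof -
  have "continuous_on {0..} (\<lambda>\<tau>. S (\<tau> + t) x)"
    using assms by (intro continuous_on_compose2[OF S_cont] continuous_intros) auto
  then have "(\<lambda>\<tau>. S (\<tau> + t) x) integrable_on {0..r}" "(\<lambda>\<tau>. S \<tau> x) integrable_on {0..r}"
    by (auto intro!: integrable_continuous_real intro: continuous_on_subset[OF S_cont]
        elim: continuous_on_subset)
  then have "integral {0..r} (\<lambda>\<tau>. S (\<tau> + t) x - S \<tau> x) =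
      integral {0..r} (\<lambda>\<tau>. S (\<tau> + t) x) - integral {0..r} (\<lambda>\<tau>. S \<tau> x)"
    by (rule Henstock_Kurzweil_Integration.integral_diff)
  moreover have "S r (S t x) = integral {0..r} (\<lambda>\<tau>. S (\<tau> + t) x - S \<tau> x)"
    using S assms unfolding integrated_semigroup_def by blast
  ultimately show ?thesis
    using integral_Ici_shift[OF S_cont assms] by (simp add: V_def)
qed

lemma S_comm:
  assumes "r \<ge> 0" "t \<ge> 0"
  shows "S r (S t x) = S t (S r x)"
  using S_S[OF assms] S_S[OF assms(2,1)] by (simp add: add.commute)

lemma V_has_derivative:
  "t \<ge> 0 \<Longrightarrow> ((\<lambda>t. V t x) has_vector_derivative S t x) (at t within {0..})"
  unfolding V_def by (rule integral_has_vector_derivative_Ici[OF S_cont])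

text \<open>The defining equation \<open>S' = x + S y\<close> integrated from
  \<open>S 0 x = 0\<close>. Without a derivative, membership is a family of equations between
  bounded operators, stable under limits, integrals and commuting operators.\<close>

lemma generator_iff: "(x, y) \<in> generator S \<longleftrightarrow> (\<forall>t\<ge>0. S t x = t *\<^sub>R x + V t y)"
proof
  assume "(x, y) \<in> generator S"
  then obtain E where E: "\<And>t. t \<ge> 0 \<Longrightarrow> ((\<lambda>s. S s x) has_vector_derivative E t) (at t within {0..})"
    and y: "\<And>t. t \<ge> 0 \<Longrightarrow> vector_derivative (\<lambda>s. S s x) (at t within {0..}) - x = S t y"
    by (auto simp: generator_def C1_vectors_def)
  have E_eq: "E t = x + S t y" if "t \<ge> 0" for t
    using vector_derivative_within[OF at_within_Ici_nontrivial[OF that] E[OF that]] y[OF that]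
    by (simp add: algebra_simps)
  show "\<forall>t\<ge>0. S t x = t *\<^sub>R x + V t y"
  proof (intro allI impI)
    fix t :: real assume t: "t \<ge> 0"
    have total: "((\<lambda>s. x + S s y) has_integral (S t x - S 0 x)) {0..t}"
    proof (rule fundamental_theorem_of_calculus[OF t])
      fix s assume "s \<in> {0..t}"
      then show "((\<lambda>s. S s x) has_vector_derivative x + S s y) (at s within {0..t})"
        using has_vector_derivative_within_subset[OF E[of s], of "{0..t}"] E_eq[of s] by auto
    qed
    have parts: "((\<lambda>s. x + S s y) has_integral (t *\<^sub>R x + V t y)) {0..t}"
    proof (rule has_integral_add)
      show "((\<lambda>s. x) has_integral t *\<^sub>R x) {0..t}"
        using has_integral_const_real[of x 0 t] t by simp
      show "((\<lambda>s. S s y) has_integral V t y) {0..t}"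
        unfolding V_def
        by (intro integrable_integral integrable_continuous_real continuous_on_subset[OF S_cont]) auto
    qed
    show "S t x = t *\<^sub>R x + V t y"
      using has_integral_unique[OF total parts] by (simp add: S_zero)
  qed
next
  assume eq: "\<forall>t\<ge>0. S t x = t *\<^sub>R x + V t y"
  have deriv: "((\<lambda>s. S s x) has_vector_derivative x + S t y) (at t within {0..})" if "t \<ge> 0" for t
  proof (rule has_vector_derivative_transform[of _ _ "\<lambda>s. S s x" "\<lambda>s. s *\<^sub>R x + V s y"])
    show "((\<lambda>s. s *\<^sub>R x + V s y) has_vector_derivative x + S t y) (at t within {0..})"
      using that by (auto intro!: derivative_eq_intros V_has_derivative)
  qed (use eq that in auto)
  then show "(x, y) \<in> generator S"
    unfolding generator_def C1_vectors_def
    using vector_derivative_within[OF at_within_Ici_nontrivial deriv]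
    by (auto intro!: exI[of _ "\<lambda>t. x + S t y"] continuous_intros S_cont)
qed

lemma bounded_clinear_V:
  assumes W: "bounded_clinear W" and comm: "\<And>r x. r \<ge> 0 \<Longrightarrow> W (S r x) = S r (W x)"
  shows "W (V t x) = V t (W x)"
proof -
  have "W (V t x) = integral {0..t} (\<lambda>s. W (S s x))"
    using bounded_clinear_exp_convolution[OF W S_cont, of 0] by (simp add: V_def exp_convolution_0)
  also have "\<dots> = V t (W x)"
    unfolding V_def by (rule integral_cong) (simp add: comm)
  finally show ?thesis .
qed

lemma generator_comm:
  assumes W: "bounded_clinear W" and comm: "\<And>r x. r \<ge> 0 \<Longrightarrow> W (S r x) = S r (W x)"
    and xy: "(x, y) \<in> generator S"
  shows "(W x, W y) \<in> generator S"
  unfolding generator_iff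
proof (intro allI impI)
  fix t :: real assume t: "t \<ge> 0"
  have "W (S t x) = W (t *\<^sub>R x + V t y)"
    using xy t by (simp add: generator_iff)
  then show "S t (W x) = t *\<^sub>R W x + V t (W y)"
    using bounded_clinear_V[OF W comm] t by (simp add: bounded_clinear_simps[OF W] comm)
qed

text \<open>By \<open>generator_iff\<close> this is an equation for
  \<open>S r (V t x) = V t (S r x)\<close>. The formula \<open>V_S\<close> is symmetric in its two
  times except for its last term, so exchanging \<open>r\<close> and \<open>t\<close> gives the
  claim.\<close>

lemma generator_V:
  assumes t: "t \<ge> 0"
  shows "(V t x, S t x - t *\<^sub>R x) \<in> generator S"
  unfolding generator_iff
proof (intro allI impI)
  fix r :: real assume r: "r \<ge> 0"
  define U where "U t = integral {0..t} (\<lambda>s. V s x)" for t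
  have int: "(\<lambda>s. V s x) integrable_on {0..b}" for b
    by (intro integrable_continuous_real continuous_on_subset[OF V_cont]) auto
  \<comment> \<open>The functional equation \<open>S_S\<close> integrated over its first
    time.\<close>
  have V_S: "V a (S b x) = U (a + b) - U b - U a - a *\<^sub>R V b x" if a: "a \<ge> 0" and b: "b \<ge> 0" for a b
  proof -
    have "continuous_on {0..} (\<lambda>s. V (s + b) x)"
      using b by (intro continuous_on_compose2[OF V_cont] continuous_intros) auto
    then have int': "(\<lambda>s. V (s + b) x) integrable_on {0..a}"
      by (intro integrable_continuous_real) (auto elim: continuous_on_subset)
    have "V a (S b x) = integral {0..a} (\<lambda>s. (V (s + b) x - V s x) - V b x)"
      unfolding V_def[of a] by (rule integral_cong) (use b in \<open>simp add: S_S\<close>)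
    also have "\<dots> = integral {0..a} (\<lambda>s. V (s + b) x) - U a - a *\<^sub>R V b x"
      using a int int' by (simp add: Henstock_Kurzweil_Integration.integral_diff
          integrable_diff integrable_const_ivl U_def)
    also have "integral {0..a} (\<lambda>s. V (s + b) x) = U (a + b) - U b"
      unfolding U_def by (rule integral_Ici_shift[OF V_cont a b])
    finally show ?thesis
      by simp
  qed
  have "S r (V t x) = V t (S r x)"
    by (rule bounded_clinear_V[OF S_lin[OF r]]) (rule S_comm[OF r])
  also have "\<dots> = r *\<^sub>R V t x + V r (S t x - t *\<^sub>R x)"
    using V_S[OF t r] V_S[OF r t] by (simp add: bounded_clinear_simps[OF V_lin[OF r]] add.commute)
  finally show "S r (V t x) = r *\<^sub>R V t x + V r (S t x - t *\<^sub>R x)" .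
qed

lemma generator_linear:
  assumes "(x, y) \<in> generator S" "(x', y') \<in> generator S"
  shows "(x + x', y + y') \<in> generator S" "(a *\<^sub>C x, a *\<^sub>C y) \<in> generator S"
  using assms
  by (auto simp: generator_iff bounded_clinear_simps[OF V_lin] bounded_clinear_simps[OF S_lin]
      scaleR_add_right scaleC_add_right scaleC_scaleR)

text \<open>Convolution passes through each bounded operator in \<open>generator_iff\<close>, so the
  equations for the pairs \<open>(f s, h s)\<close> integrate to the equation for the convolved
  pair.\<close>

lemma exp_convolution_generator:
  assumes f: "continuous_on {0..} f" and h: "continuous_on {0..} h" and t: "t \<ge> 0"
    and fh: "\<And>s. s \<ge> 0 \<Longrightarrow> (f s, h s) \<in> generator S"
  shows "(exp_convolution c f t, exp_convolution c h t) \<in> generator S"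
  unfolding generator_iff
proof (intro allI impI)
  fix r :: real assume r: "r \<ge> 0"
  have rf: "bounded_clinear (\<lambda>x :: 'a. r *\<^sub>R x)"
    using bounded_clinear_scaleC[of "complex_of_real r"] by (simp add: scaleC_of_real)
  have "S r (exp_convolution c f t) = exp_convolution c (\<lambda>s. S r (f s)) t"
    by (rule bounded_clinear_exp_convolution[OF S_lin[OF r] f])
  also have "\<dots> = exp_convolution c (\<lambda>s. r *\<^sub>R f s + V r (h s)) t"
    unfolding exp_convolution_def
    by (intro arg_cong[where f = "\<lambda>y. _ *\<^sub>C y"] integral_cong)
      (use fh r in \<open>simp add: generator_iff\<close>)
  also have "\<dots> = exp_convolution c (\<lambda>s. r *\<^sub>R f s) t + exp_convolution c (\<lambda>s. V r (h s)) t"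
    by (intro exp_convolution_add continuous_intros f h
        bounded_linear.continuous_on[OF bounded_clinear_bounded_linear[OF V_lin[OF r]]])
  also have "\<dots> = r *\<^sub>R exp_convolution c f t + V r (exp_convolution c h t)"
    using bounded_clinear_exp_convolution[OF rf f] bounded_clinear_exp_convolution[OF V_lin[OF r] h]
    by simp
  finally show "S r (exp_convolution c f t) = r *\<^sub>R exp_convolution c f t + V r (exp_convolution c h t)" .
qed

text \<open>If \<open>y\<close> and \<open>y'\<close> are both values at \<open>x\<close>, then
  \<open>V t (y - y') = 0\<close> for all \<open>t\<close>; differentiating gives
  \<open>S t (y - y') = 0\<close>, and nondegeneracy forces \<open>y = y'\<close>. Closedness holds
  because the graph is an intersection of null spaces of continuous maps.\<close>

lemma closed_operator_generator:
  assumes "nondegenerate S"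
  shows "closed_operator (generator S)"
  unfolding closed_operator_def linear_operator_def
proof (intro conjI allI impI)
  show "single_valued (generator S)"
    unfolding single_valued_def
  proof (intro allI impI)
    fix x y y' assume "(x, y) \<in> generator S" "(x, y') \<in> generator S"
    then have V0: "V t (y - y') = 0" if "t \<ge> 0" for t
      using that by (auto simp: generator_iff bounded_clinear_simps[OF V_lin])
    have "S t (y - y') = 0" if t: "t \<ge> 0" for t
    proof (rule vector_derivative_unique_within[OF at_within_Ici_nontrivial[OF t] V_has_derivative[OF t]])
      show "((\<lambda>t. V t (y - y')) has_vector_derivative 0) (at t within {0..})"
        by (rule has_vector_derivative_transform[where f = "\<lambda>_. 0"]) (use t V0 in auto)
    qed
    then have "y - y' \<in> {x. \<forall>t\<ge>0. S t x = 0}"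
      by simp
    then show "y = y'"
      unfolding assms[unfolded nondegenerate_def] by simp
  qed
  show "(0, 0) \<in> generator S"
    by (auto simp: generator_iff bounded_clinear_simps[OF S_lin] bounded_clinear_simps[OF V_lin])
  have "generator S = (\<Inter>t\<in>{0..}. (\<lambda>z. S t (fst z) - (t *\<^sub>R fst z + V t (snd z))) -` {0})"
    by (auto simp: generator_iff)
  also have "closed \<dots>"
    by (intro closed_INT ballI continuous_closed_vimage continuous_intros
        bounded_linear.continuous[OF bounded_clinear_bounded_linear[OF S_lin]]
        bounded_linear.continuous[OF bounded_clinear_bounded_linear[OF V_lin]]) auto
  finally show "closed (generator S)" .
qed (auto intro: generator_linear)

lemma exp_convolution_S_comm:
  assumes P: "strongly_continuous_family P"
    and comm: "\<And>s r x. s \<ge> 0 \<Longrightarrow> r \<ge> 0 \<Longrightarrow> P s (S r x) = S r (P s x)" and r: "r \<ge> 0"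
  shows "exp_convolution c (\<lambda>s. P s (S r x)) t = S r (exp_convolution c (\<lambda>s. P s x) t)"
  unfolding bounded_clinear_exp_convolution[OF S_lin[OF r] strongly_continuous_familyD(2)[OF P]]
  unfolding exp_convolution_def
  by (intro arg_cong[where f = "\<lambda>y. _ *\<^sub>C y"] integral_cong) (simp add: comm r)

section \<open>Factorization through the shifted generator\<close>

text \<open>\<open>D\<close>, \<open>L\<close> and \<open>L'\<close> are the first three iterated
  convolutions of \<open>S\<close>. The relation \<open>B D = S - g\<close> is computed directly;
  convolving it once and twice yields the other two, while \<open>g\<close> turns into
  \<open>k\<close> and the convolution of \<open>k\<close>.\<close>

lemma resolvent_factorization:
  fixes c :: complex
  assumes nondeg: "nondegenerate S" and t: "t > 0"
  defines "g \<equiv> \<lambda>t. integral {0..t} (\<lambda>s. exp (c * complex_of_real s))"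
  defines "k \<equiv> exp_convolution c g"
  defines "D \<equiv> \<lambda>t x. exp_convolution c (\<lambda>s. S s x) t"
  defines "L \<equiv> \<lambda>t x. exp_convolution c (\<lambda>s. D s x) t"
  shows "resolvent_factorization (minus_scalar (generator S) c) (\<lambda>x. S t x - g t *\<^sub>C x)
    (D t) (L t) (\<lambda>x. exp_convolution c (\<lambda>s. L s x) t) (k t) (exp_convolution c k t)"
proof -
  define B where "B = minus_scalar (generator S) c"
  define L' where "L' t x = exp_convolution c (\<lambda>s. L s x) t" for t x
  have D: "strongly_continuous_family D"
    unfolding D_def by (rule strongly_continuous_family_exp_convolution[OF S_family])
  have L: "strongly_continuous_family L"
    unfolding L_def by (rule strongly_continuous_family_exp_convolution[OF D])
  have L': "strongly_continuous_family L'"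
    unfolding L'_def[abs_def] by (rule strongly_continuous_family_exp_convolution[OF L])
  note lins = strongly_continuous_familyD(1)[OF D] strongly_continuous_familyD(1)[OF L]
    strongly_continuous_familyD(1)[OF L']
  note conts = strongly_continuous_familyD(2)[OF D] strongly_continuous_familyD(2)[OF L]
  have D_comm: "D s (S r x) = S r (D s x)" if "s \<ge> 0" "r \<ge> 0" for s r x
    unfolding D_def by (rule exp_convolution_S_comm[OF S_family S_comm that(2)])
  have L_comm: "L s (S r x) = S r (L s x)" if "s \<ge> 0" "r \<ge> 0" for s r x
    unfolding L_def by (rule exp_convolution_S_comm[OF D D_comm that(2)])
  have L'_comm: "L' s (S r x) = S r (L' s x)" if "s \<ge> 0" "r \<ge> 0" for s r x
    unfolding L'_def by (rule exp_convolution_S_comm[OF L L_comm that(2)])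
  have B_comm: "(W x, W y) \<in> B" if W: "bounded_clinear W"
    and comm: "\<And>r x. r \<ge> 0 \<Longrightarrow> W (S r x) = S r (W x)" and xy: "(x, y) \<in> B" for W x y
    using generator_comm[OF W comm xy[unfolded B_def mem_minus_scalar]]
    by (simp add: B_def mem_minus_scalar bounded_clinear_simps[OF W])
  \<comment> \<open>Convolution preserves the generator and commutes with multiplication by
    \<open>c\<close>, hence it preserves \<open>B\<close>.\<close>
  have B_conv: "(exp_convolution c f r, exp_convolution c h r) \<in> B"
    if f: "continuous_on {0..} f" and h: "continuous_on {0..} h" and r: "r \<ge> 0"
      and fh: "\<And>s. s \<ge> 0 \<Longrightarrow> (f s, h s) \<in> B" for f h r
  proof -
    have cf: "continuous_on {0..} (\<lambda>s. c *\<^sub>C f s)"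
      by (intro continuous_intros f)
    have "(exp_convolution c f r, exp_convolution c (\<lambda>s. h s + c *\<^sub>C f s) r) \<in> generator S"
      using fh by (intro exp_convolution_generator f continuous_on_add h cf r)
        (simp add: B_def mem_minus_scalar)
    then show ?thesis
      by (simp add: B_def mem_minus_scalar exp_convolution_add h cf exp_convolution_scaleC f)
  qed
  have g: "continuous_on {0..} g"
    unfolding g_def by (rule continuous_on_integral_exp)
  have k: "continuous_on {0..} k"
    unfolding k_def by (rule continuous_on_exp_convolution[OF g])
  \<comment> \<open>Integration by parts writes \<open>D\<close> as \<open>V\<close> plus
    \<open>c\<close> times the convolution of \<open>V\<close>. Both terms lie in the domain of the
    generator, with images \<open>h = S - s\<close> and \<open>c\<close> times the convolution of
    \<open>h\<close>.\<close>
  have D_B: "(D r x, S r x - g r *\<^sub>C x) \<in> B" if r: "r \<ge> 0" for r x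
  proof -
    define h where "h = (\<lambda>s. S s x - s *\<^sub>R x)"
    have sx: "continuous_on {0..} (\<lambda>s. s *\<^sub>R x)"
      by (intro continuous_intros)
    have h: "continuous_on {0..} h"
      unfolding h_def by (intro continuous_on_diff S_cont sx)
    have "(exp_convolution c (\<lambda>s. V s x) r, exp_convolution c h r) \<in> generator S"
      by (rule exp_convolution_generator[OF V_cont h r]) (simp add: h_def generator_V)
    from generator_linear(1)[OF generator_V[OF r] generator_linear(2)[OF this this, of c]]
    have "(V r x + c *\<^sub>C exp_convolution c (\<lambda>s. V s x) r,
        S r x - r *\<^sub>R x + c *\<^sub>C exp_convolution c h r) \<in> generator S" .
    also have "V r x + c *\<^sub>C exp_convolution c (\<lambda>s. V s x) r = D r x"
      unfolding D_def V_def using exp_convolution_by_parts[OF S_cont r] by simp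
    also have "S r x - r *\<^sub>R x + c *\<^sub>C exp_convolution c h r = S r x - g r *\<^sub>C x + c *\<^sub>C D r x"
    proof -
      have "exp_convolution c h r = D r x - exp_convolution c complex_of_real r *\<^sub>C x"
        unfolding h_def D_def exp_convolution_diff[OF S_cont sx]
        by (simp add: scaleC_of_real flip: exp_convolution_scaleC_left[OF continuous_on_of_real[OF continuous_on_id]])
      \<comment> \<open>Integration by parts for the constant function 1, whose convolution is
        \<open>g\<close>.\<close>
      moreover have "g r = of_real r + c * exp_convolution c complex_of_real r"
      proof -
        have "g r = exp_convolution c (\<lambda>_. 1) r"
          using exp_convolution_one[OF r] by (simp add: g_def)
        also have "\<dots> = integral {0..r} (\<lambda>_. 1) + c *\<^sub>C exp_convolution c (\<lambda>s. integral {0..s} (\<lambda>_. 1)) r"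
          by (rule exp_convolution_by_parts[OF continuous_on_const r])
        also have "exp_convolution c (\<lambda>s. integral {0..s} (\<lambda>_. 1)) r = exp_convolution c complex_of_real r"
          unfolding exp_convolution_def
          by (intro arg_cong[where f = "\<lambda>y. _ *\<^sub>C y"] integral_cong)
            (simp add: scaleR_conv_of_real)
        finally show ?thesis
          using r by (simp add: scaleC_complex_def scaleR_conv_of_real)
      qed
      ultimately show ?thesis
        by (simp add: scaleC_add_left scaleC_of_real complex_vector.scale_right_diff_distrib
            scaleC_scaleC)
    qed
    finally show ?thesis
      by (simp add: B_def mem_minus_scalar)
  qed
  have L_B: "(L r x, D r x - k r *\<^sub>C x) \<in> B" if r: "r \<ge> 0" for r x
  proof -
    have gx: "continuous_on {0..} (\<lambda>s. g s *\<^sub>C x)"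
      by (intro continuous_intros g)
    have "(exp_convolution c (\<lambda>s. D s x) r, exp_convolution c (\<lambda>s. S s x - g s *\<^sub>C x) r) \<in> B"
      by (rule B_conv[OF conts(1) _ r D_B]) (intro continuous_on_diff S_cont gx)
    then show ?thesis
      by (simp add: L_def D_def k_def exp_convolution_diff S_cont gx exp_convolution_scaleC_left g)
  qed
  have L'_B: "(L' r x, L r x - exp_convolution c k r *\<^sub>C x) \<in> B" if r: "r \<ge> 0" for r x
  proof -
    have kx: "continuous_on {0..} (\<lambda>s. k s *\<^sub>C x)"
      by (intro continuous_intros k)
    have "(exp_convolution c (\<lambda>s. L s x) r, exp_convolution c (\<lambda>s. D s x - k s *\<^sub>C x) r) \<in> B"
      by (rule B_conv[OF conts(2) _ r L_B]) (intro continuous_on_diff conts(1) kx)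
    then show ?thesis
      by (simp add: L'_def L_def exp_convolution_diff conts(1) kx exp_convolution_scaleC_left k)
  qed
  \<comment> \<open>Were both zero, \<open>exp (c t) t^2 / 2\<close> would vanish, contrary to
    \<open>t > 0\<close>.\<close>
  have nonzero: "k t \<noteq> 0 \<or> exp_convolution c k t \<noteq> 0"
    using double_exp_convolution_identity[of t c] t by (auto simp: k_def g_def)
  have t0: "t \<ge> 0"
    using t by simp
  have "resolvent_factorization B (\<lambda>x. S t x - g t *\<^sub>C x) (D t) (L t) (L' t) (k t) (exp_convolution c k t)"
  proof
    show "closed_operator B"
      unfolding B_def by (rule closed_operator_minus_scalar[OF closed_operator_generator[OF nondeg]])
    show "bounded_clinear (\<lambda>x. S t x - g t *\<^sub>C x)"
      by (intro bounded_clinear_diff S_lin t0 bounded_clinear_scaleC)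
    show "(D t x, D t y) \<in> B" if "(x, y) \<in> B" for x y
      by (rule B_comm[OF lins(1)[OF t0] D_comm[OF t0] that])
    show "(L t x, L t y) \<in> B" if "(x, y) \<in> B" for x y
      by (rule B_comm[OF lins(2)[OF t0] L_comm[OF t0] that])
    show "(L' t x, L' t y) \<in> B" if "(x, y) \<in> B" for x y
      by (rule B_comm[OF lins(3)[OF t0] L'_comm[OF t0] that])
  qed (use lins t0 D_B L_B L'_B nonzero in auto)
  then show ?thesis
    unfolding B_def L'_def[abs_def] .
qed

end

section \<open>The spectral inclusions\<close>

theorem theorem2p1:
  fixes S :: "real \<Rightarrow> 'a :: complex_banach \<Rightarrow> 'a" and t :: real
  assumes "integrated_semigroup S"
    and "nondegenerate S"
    and "t > 0"
  shows "{integral {0..t} (\<lambda>s. exp (c * complex_of_real s)) | c. c \<in> saphar_spectrum (generator S)}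
           \<subseteq> saphar_spectrum (operator_of (S t)) \<and>
         {integral {0..t} (\<lambda>s. exp (c * complex_of_real s)) | c. c \<in> ess_saphar_spectrum (generator S)}
           \<subseteq> ess_saphar_spectrum (operator_of (S t))"
proof -
  interpret strongly_continuous_integrated_semigroup S
    by standard (rule assms(1))
  have eq: "minus_scalar (operator_of (S t)) a = operator_of (\<lambda>x. S t x - a *\<^sub>C x)" for a
    by (auto simp: minus_scalar_def operator_of_def)
  \<comment> \<open>Both inclusions are contrapositives: if \<open>S(t) - g(t)\<close> is Saphar or
    essentially Saphar, the factorization transfers this to the generator shifted by
    \<open>c\<close>.\<close>
  note fact = resolvent_factorization[OF assms(2,3)]
  show ?thesis
    unfolding saphar_spectrum_def ess_saphar_spectrum_def eq
    using resolvent_factorization.saphar_transfer[OF fact]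
      resolvent_factorization.essentially_saphar_transfer[OF fact]
    by blast
qed

end
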